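(* Let $A,B$ be $\mathbb{N}_0$-valued random variables with $0<\mu:=E(A)<1$ satisfying one of the following two sets of assumptions. Model I: $P(B>x)=x^{-\alpha}L(x)$ for some $\alpha\in(0,2)$, $\alpha\ne1$, and some slowly varying function $L$; and, if $\alpha\in(1,2)$, also $E(A^2)<\infty$. Model II: $P(A>x)=x^{-\alpha}L(x)$ for some $\alpha\in(1,2)$ and some slowly varying function $L$; $\lim_{x\to\infty}P(B>x)/P(A>x)=c$ for some finite $c\ge0$; and, if $c>0$, $B$ is consistently varying. Let $(X_t)_{t\in\mathbb{Z}}$ be the stationary branching process with immigration with offspring variable $A$ and immigration variable $B$, let $M_n=\max(X_1,\dots,X_n)$, and let $(a_n)$ be a sequence of constants such that $nP(X_0>a_nu)\to u^{-\alpha}$ as $n\to\infty$ for every $u>0$. Then, for every $x\ge0$, $$P\left(\frac{M_n}{a_n}\le x\right)\to\exp\left(-(1-\mu^\alpha)x^{-\alpha}\right)\qquad\text{as } n\to\infty,$$ where the right-hand side is interpreted as $0$ for $x=0$.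
   Context: $\mathbb{N}_0=\{0,1,2,\dots\}$. The stationary branching process with immigration is the strictly stationary process $(X_t)_{t\in\mathbb{Z}}$ with values in $\mathbb{N}_0$ satisfying $X_t=\sum_{i=1}^{X_{t-1}}A^{(t)}_i+B_t$ for all $t$, where $(A^{(t)}_i)_{i,t}$ are i.i.d. copies of $A$, $(B_t)_t$ are i.i.d. copies of $B$ independent of the $A^{(t)}_i$, and $X_{t-1}$ is independent of $\{A^{(s)}_i,B_s: s\ge t,\ i\ge1\}$. A nonnegative random variable $B$ is consistently varying if $\lim_{\lambda\downarrow1}\liminf_{x\to\infty}P(B>\lambda x)/P(B>x)=1$. Under the stated assumptions $X_0$ is regularly varying with index $\alpha$, so a sequence of constants $(a_n)$ such that $nP(X_0>a_nu)\to u^{-\alpha}$ as $n\to\infty$ for every $u>0$ exists and tends to $\infty$. *)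

theory Defs
  imports "HOL-Probability.Probability"
begin

definition slowly_varying :: "(real \<Rightarrow> real) \<Rightarrow> bool" where
  "slowly_varying L \<longleftrightarrow>
     L \<in> borel_measurable borel \<and>
     (\<forall>\<^sub>F x in at_top. L x > 0) \<and>
     (\<forall>r>0. ((\<lambda>x. L (r * x) / L x) \<longlongrightarrow> 1) at_top)"

text \<open>The tail is \<open>P(Y > x) = x\<^sup>-\<^sup>\<alpha> L(x)\<close>, \<open>x > 0\<close>, for some slowly varying \<open>L\<close>.\<close>

definition regularly_varying_tail :: "'a measure \<Rightarrow> ('a \<Rightarrow> nat) \<Rightarrow> real \<Rightarrow> bool" where
  "regularly_varying_tail N Y \<alpha> \<longleftrightarrow>
     (\<exists>L. slowly_varying L \<and>
        (\<forall>x>0. \<P>(\<omega> in N. real (Y \<omega>) > x) = x powr (-\<alpha>) * L x))"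

definition consistently_varying :: "'a measure \<Rightarrow> ('a \<Rightarrow> nat) \<Rightarrow> bool" where
  "consistently_varying N Y \<longleftrightarrow>
     ((\<lambda>r. Liminf at_top
        (\<lambda>x. ereal (\<P>(\<omega> in N. real (Y \<omega>) > r * x) / \<P>(\<omega> in N. real (Y \<omega>) > x)))) \<longlongrightarrow> 1) (at_right 1)"

definition model_I :: "'a measure \<Rightarrow> ('a \<Rightarrow> nat) \<Rightarrow> ('a \<Rightarrow> nat) \<Rightarrow> real \<Rightarrow> bool" where
  "model_I N A B \<alpha> \<longleftrightarrow>
     0 < \<alpha> \<and> \<alpha> < 2 \<and> \<alpha> \<noteq> 1 \<and>
     regularly_varying_tail N B \<alpha> \<and>
     (1 < \<alpha> \<longrightarrow> integrable N (\<lambda>\<omega>. (real (A \<omega>))\<^sup>2))"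

definition model_II :: "'a measure \<Rightarrow> ('a \<Rightarrow> nat) \<Rightarrow> ('a \<Rightarrow> nat) \<Rightarrow> real \<Rightarrow> bool" where
  "model_II N A B \<alpha> \<longleftrightarrow>
     1 < \<alpha> \<and> \<alpha> < 2 \<and>
     regularly_varying_tail N A \<alpha> \<and>
     (\<exists>c\<ge>0.
        ((\<lambda>x. \<P>(\<omega> in N. real (B \<omega>) > x) / \<P>(\<omega> in N. real (A \<omega>) > x)) \<longlongrightarrow> c) at_top \<and>
        (c > 0 \<longrightarrow> consistently_varying N B))"

text \<open>The offspring variables \<open>As t i\<close> (used for \<open>i \<ge> 1\<close> only) and the immigration variables
  \<open>Bs t\<close> as a single family, so that their joint independence is one use of \<open>indep_vars\<close>.\<close>

fun noise :: "(int \<Rightarrow> nat \<Rightarrow> 'a \<Rightarrow> nat) \<Rightarrow> (int \<Rightarrow> 'a \<Rightarrow> nat) \<Rightarrow> (int \<times> nat) + int \<Rightarrow> 'a \<Rightarrow> nat" where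
  "noise As Bs (Inl (t, i)) = As t i"
| "noise As Bs (Inr t) = Bs t"

definition noise_from :: "int \<Rightarrow> ((int \<times> nat) + int) set" where
  "noise_from t = ({t..} \<times> {1..}) <+> {t..}"

definition strictly_stationary :: "'a measure \<Rightarrow> (int \<Rightarrow> 'a \<Rightarrow> nat) \<Rightarrow> bool" where
  "strictly_stationary M X \<longleftrightarrow>
     (\<forall>t. X t \<in> measurable M (count_space UNIV)) \<and>
     (\<forall>h. distr M (\<Pi>\<^sub>M t\<in>UNIV. count_space UNIV) (\<lambda>\<omega> t. X (t + h) \<omega>) =
          distr M (\<Pi>\<^sub>M t\<in>UNIV. count_space UNIV) (\<lambda>\<omega> t. X t \<omega>))"

text \<open>The generic variables \<open>A\<close>, \<open>B\<close> live on \<open>N\<close> and only their laws matter; the process and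
  its driving variables live on \<open>M\<close>. The last clause says that \<open>X (t - 1)\<close> is independent of the
  whole noise family from time \<open>t\<close> on. It is phrased with the generated \<open>\<sigma>\<close>-algebras because
  \<open>indep_var\<close> requires both variables to take values in the same type.\<close>

definition stationary_branching_process ::
  "'b measure \<Rightarrow> ('b \<Rightarrow> nat) \<Rightarrow> ('b \<Rightarrow> nat) \<Rightarrow>
   'a measure \<Rightarrow> (int \<Rightarrow> nat \<Rightarrow> 'a \<Rightarrow> nat) \<Rightarrow> (int \<Rightarrow> 'a \<Rightarrow> nat) \<Rightarrow> (int \<Rightarrow> 'a \<Rightarrow> nat) \<Rightarrow> bool" where
  "stationary_branching_process N A B M As Bs X \<longleftrightarrow>
     prob_space M \<and>
     (\<forall>t. \<forall>i\<ge>1. distr M (count_space UNIV) (As t i) = distr N (count_space UNIV) A) \<and>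
     (\<forall>t. distr M (count_space UNIV) (Bs t) = distr N (count_space UNIV) B) \<and>
     prob_space.indep_vars M (\<lambda>_. count_space UNIV) (noise As Bs) ((UNIV \<times> {1..}) <+> UNIV) \<and>
     strictly_stationary M X \<and>
     (\<forall>t. AE \<omega> in M. X t \<omega> = (\<Sum>i=1..X (t - 1) \<omega>. As t i \<omega>) + Bs t \<omega>) \<and>
     (\<forall>t. prob_space.indep_set M
            (sets (vimage_algebra (space M) (X (t - 1)) (count_space UNIV)))
            (sets (vimage_algebra (space M)
               (\<lambda>\<omega>. \<lambda>k\<in>noise_from t. noise As Bs k \<omega>)
               (\<Pi>\<^sub>M k\<in>noise_from t. count_space UNIV))))"

end

theory Submission imports Defs "HOL-Real_Asymp.Real_Asymp" begin

text \<open>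
  Fix a high level \<open>u\<close> and let \<open>p k = P(X\<^sub>1 \<le> u, \<dots>, X\<^sub>k \<le> u)\<close>. By stationarity, decomposing
  according to the state at time 0,
  \<open>p k - p (k + 1) = P(X\<^sub>0 > u, X\<^sub>1 \<le> u, \<dots>, X\<^sub>k \<le> u)\<close>: each decrement is the probability
  that an exceedance is the last one for \<open>k\<close> steps. If this probability is close to
  \<open>q p k\<close> with \<open>q = P(u < X\<^sub>0 \<le> u / \<mu>)\<close>, then \<open>p n\<close> is close to \<open>(1 - q)\<^sup>n\<close>. For
  \<open>u = a\<^sub>n x\<close> the choice of the norming constants gives
  \<open>n q \<rightarrow> x\<^sup>-\<^sup>\<alpha> - (x / \<mu>)\<^sup>-\<^sup>\<alpha> = (1 - \<mu>\<^sup>\<alpha>) x\<^sup>-\<^sup>\<alpha>\<close>, which is the asserted limit.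

  Two facts justify the approximation of the decrement.

  Law of large numbers. From a large state \<open>m\<close> the offspring sum of the next step is about
  \<open>\<mu> m\<close>. Hence a state above \<open>(1 + \<epsilon>) u / \<mu>\<close> is followed by another exceedance, whereas from a state
  below \<open>(1 - \<epsilon>) u / \<mu>\<close> the descendants of the present population stay below \<open>u\<close> with high
  probability. The offspring variance may be infinite; therefore the lower deviation is bounded by
  a Laplace transform (\<open>gw_lower_deviation\<close>) and the upper deviation is deduced from it, because
  the positive and the negative part of \<open>S - E S\<close> have the same mean (\<open>gw_mean_excess\<close>).

  Coupling. The chain started from \<open>x + z\<close> is the chain started from \<open>x\<close> plus an independent
  Galton-Watson process without immigration started from \<open>z\<close>. The two chains disagree about
  \<open>\<le> u\<close> at time \<open>j\<close> only if the Galton-Watson part lifts the sum over \<open>u\<close>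
  (\<open>stay_le_stay_add\<close>), and this part has mean \<open>\<mu>\<^sup>j z\<close>, which decays geometrically. Taking \<open>x = 0\<close> and
  \<open>z\<close> stationary compares the chain started from \<open>0\<close> with the stationary one
  (\<open>eventually_stay_0_le\<close>) and yields the upper bound of the decrement; taking \<open>x\<close>
  stationary and \<open>z \<le> (1 - \<epsilon>) u / \<mu>\<close> fixed yields the lower bound
  (\<open>eventually_no_exceedance_le_stay\<close>).

  All of this takes place for the Markov chain with a transition kernel of type \<open>nat \<Rightarrow> nat pmf\<close>. That the
  given process has the path law of this chain (\<open>prob_path\<close>) follows from the independence of
  \<open>X\<^sub>t\<close> from the later noise and from the independence of the noise blocks of different times.
\<close>

section \<open>Convolutions, iterated kernels and the probability of staying below a level\<close>

definition conv_pmf :: "nat pmf \<Rightarrow> nat pmf \<Rightarrow> nat pmf" where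
  "conv_pmf p q = map_pmf (\<lambda>(x, y). x + y) (pair_pmf p q)"

lemma nn_integral_conv_pmf:
  "(\<integral>\<^sup>+s. f s \<partial>conv_pmf p q) = (\<integral>\<^sup>+x. \<integral>\<^sup>+y. f (x + y) \<partial>q \<partial>p)"
  by (simp add: conv_pmf_def nn_integral_pair_pmf' case_prod_beta)

lemma pmf_eqI_nn_integral:
  assumes "\<And>f. (\<integral>\<^sup>+x. f x \<partial>measure_pmf p) = (\<integral>\<^sup>+x. f x \<partial>measure_pmf q)"
  shows "p = q"
proof (rule pmf_eqI)
  fix i
  have "emeasure p {i} = emeasure q {i}"
    using assms[of "indicator {i}"] by simp
  then show "pmf p i = pmf q i"
    by (simp add: emeasure_pmf_single)
qed

lemma nn_integral_pmf_swap:
  "(\<integral>\<^sup>+x. \<integral>\<^sup>+y. f x y \<partial>measure_pmf q \<partial>measure_pmf p) = (\<integral>\<^sup>+y. \<integral>\<^sup>+x. f x y \<partial>measure_pmf p \<partial>measure_pmf q)"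
proof -
  have "(\<integral>\<^sup>+x. \<integral>\<^sup>+y. f x y \<partial>q \<partial>p) = (\<integral>\<^sup>+z. f (fst z) (snd z) \<partial>pair_pmf p q)"
    by (simp add: nn_integral_pair_pmf')
  also have "\<dots> = (\<integral>\<^sup>+y. \<integral>\<^sup>+x. f x y \<partial>p \<partial>q)"
    by (subst pair_commute_pmf) (simp add: nn_integral_pair_pmf' case_prod_beta)
  finally show ?thesis .
qed

lemma conv_pmf_assoc: "conv_pmf (conv_pmf p q) r = conv_pmf p (conv_pmf q r)"
  by (rule pmf_eqI_nn_integral) (simp add: nn_integral_conv_pmf add.assoc)

lemma conv_pmf_commute: "conv_pmf p q = conv_pmf q p"
  by (rule pmf_eqI_nn_integral)
     (subst (1 2) nn_integral_conv_pmf, subst nn_integral_pmf_swap, simp add: add.commute)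

lemma conv_return_pmf_0 [simp]: "conv_pmf (return_pmf 0) p = p" "conv_pmf p (return_pmf 0) = p"
  by (rule pmf_eqI_nn_integral; simp add: nn_integral_conv_pmf)+

primrec sum_iid_pmf :: "nat pmf \<Rightarrow> nat \<Rightarrow> nat pmf" where
  "sum_iid_pmf p 0 = return_pmf 0"
| "sum_iid_pmf p (Suc n) = conv_pmf p (sum_iid_pmf p n)"

lemma sum_iid_pmf_add: "sum_iid_pmf p (m + n) = conv_pmf (sum_iid_pmf p m) (sum_iid_pmf p n)"
  by (induction m) (simp_all add: conv_pmf_assoc)

lemma nn_integral_sum_iid_pmf:
  assumes "(\<integral>\<^sup>+x. ennreal (real x) \<partial>measure_pmf p) = ennreal \<mu>" "\<mu> \<ge> 0"
  shows "(\<integral>\<^sup>+x. ennreal (real x) \<partial>sum_iid_pmf p n) = ennreal (\<mu> * real n)"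
proof (induction n)
  case 0
  show ?case by simp
next
  case (Suc n)
  have "(\<integral>\<^sup>+x. ennreal (real x) \<partial>sum_iid_pmf p (Suc n)) =
      (\<integral>\<^sup>+x. \<integral>\<^sup>+y. ennreal (real x) + ennreal (real y) \<partial>sum_iid_pmf p n \<partial>p)"
    by (simp add: nn_integral_conv_pmf)
  also have "\<dots> = ennreal \<mu> + ennreal (\<mu> * real n)"
    by (simp add: nn_integral_add Suc.IH assms(1) measure_pmf.emeasure_space_1)
  also have "\<dots> = ennreal (\<mu> * real (Suc n))"
    using assms(2) by (subst ennreal_plus[symmetric]) (auto simp: algebra_simps)
  finally show ?case .
qed

lemma nn_integral_power_sum_iid_pmf:
  "(\<integral>\<^sup>+y. ennreal (exp (- (s * real y))) \<partial>sum_iid_pmf p z) = (\<integral>\<^sup>+y. ennreal (exp (- (s * real y))) \<partial>p) ^ z"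
proof (induction z)
  case (Suc z)
  have "(\<integral>\<^sup>+y. ennreal (exp (- (s * real y))) \<partial>sum_iid_pmf p (Suc z)) =
      (\<integral>\<^sup>+x. \<integral>\<^sup>+y. ennreal (exp (- (s * real x))) * ennreal (exp (- (s * real y))) \<partial>sum_iid_pmf p z \<partial>p)"
    by (simp add: nn_integral_conv_pmf ennreal_mult[symmetric] distrib_left flip: exp_add)
  also have "\<dots> = (\<integral>\<^sup>+y. ennreal (exp (- (s * real y))) \<partial>p) ^ Suc z"
    by (simp add: nn_integral_cmult nn_integral_multc Suc.IH)
  finally show ?case .
qed simp

lemma emeasure_pmf_Markov:
  assumes "0 < w"
    and "(\<integral>\<^sup>+y. f y \<partial>measure_pmf p) \<le> ennreal c" "0 \<le> c"
    and "\<And>y. y \<in> S \<Longrightarrow> ennreal w \<le> f y"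
  shows "emeasure p S \<le> ennreal (c / w)"
proof -
  have "ennreal w * emeasure p S = (\<integral>\<^sup>+y. ennreal w * indicator S y \<partial>p)"
    by (simp add: nn_integral_cmult)
  also have "\<dots> \<le> (\<integral>\<^sup>+y. f y \<partial>p)"
    using assms(4) by (intro nn_integral_mono) (auto simp: indicator_def)
  finally have *: "ennreal w * emeasure p S \<le> ennreal c"
    using assms(2) by (rule order_trans)
  have "emeasure p S = ennreal (1 / w) * (ennreal w * emeasure p S)"
    using assms(1) by (simp add: mult.assoc[symmetric] ennreal_mult[symmetric])
  also have "\<dots> \<le> ennreal (1 / w) * ennreal c"
    by (intro mult_left_mono *) simp
  also have "\<dots> = ennreal (c / w)"
    using assms(1,3) by (simp add: ennreal_mult[symmetric])
  finally show ?thesis .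
qed

text \<open>The law after \<open>j\<close> steps. The first step is split off, which fits inductions that vary
  the starting state.\<close>

primrec iterate_pmf :: "('s \<Rightarrow> 's pmf) \<Rightarrow> nat \<Rightarrow> 's \<Rightarrow> 's pmf" where
  "iterate_pmf K 0 x = return_pmf x"
| "iterate_pmf K (Suc j) x = bind_pmf (K x) (iterate_pmf K j)"

lemma bind_iterate_pmf_invariant:
  assumes "bind_pmf \<pi> K = \<pi>"
  shows "bind_pmf \<pi> (iterate_pmf K j) = \<pi>"
proof (induction j)
  case 0
  have "iterate_pmf K 0 = return_pmf" by (simp add: fun_eq_iff)
  then show ?case by (simp add: bind_return_pmf')
next
  case (Suc j)
  have "iterate_pmf K (Suc j) = (\<lambda>x. bind_pmf (K x) (iterate_pmf K j))"
    by (simp add: fun_eq_iff)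
  then show ?case
    using Suc.IH assms by (simp add: bind_assoc_pmf[symmetric])
qed

text \<open>The probability that the Markov chain with kernel \<open>K\<close>, started from \<open>x\<close>, is at most \<open>u\<close> at
  the times \<open>1, \<dots>, k\<close>; the starting state itself is not tested. Values in
  \<^typ>\<open>ennreal\<close> make all expectations below unconditional.\<close>

primrec stay_below :: "(nat \<Rightarrow> nat pmf) \<Rightarrow> real \<Rightarrow> nat \<Rightarrow> nat \<Rightarrow> ennreal" where
  "stay_below K u 0 x = 1"
| "stay_below K u (Suc k) x = (\<integral>\<^sup>+y. (if real y \<le> u then stay_below K u k y else 0) \<partial>K x)"

lemma stay_below_le_1: "stay_below K u k x \<le> 1"
proof (induction k arbitrary: x)
  case (Suc k)
  have "stay_below K u (Suc k) x \<le> (\<integral>\<^sup>+y. 1 \<partial>K x)"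
    unfolding stay_below.simps by (intro nn_integral_mono) (use Suc.IH in auto)
  then show ?case by (simp add: measure_pmf.emeasure_space_1)
qed simp

section \<open>The coupling of chains started from different states\<close>

locale branching_kernel =
  fixes pA pB :: "nat pmf"
begin

definition gw :: "nat \<Rightarrow> nat pmf" where "gw z = sum_iid_pmf pA z"

definition step :: "nat \<Rightarrow> nat pmf" where "step x = conv_pmf (gw x) pB"

abbreviation stay where "stay \<equiv> stay_below step"

lemma gw_add: "gw (x + z) = conv_pmf (gw x) (gw z)"
  by (simp add: gw_def sum_iid_pmf_add)

text \<open>The branching property: \<open>x + z\<close> individuals and one immigration batch are \<open>x\<close> individuals
  with that batch, together with an independent population of \<open>z\<close> individuals without immigration.\<close>

lemma step_add: "step (x + z) = conv_pmf (step x) (gw z)"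
  unfolding step_def gw_add conv_pmf_assoc by (simp add: conv_pmf_commute)

lemma iterate_step_add:
  "iterate_pmf step j (x + z) = conv_pmf (iterate_pmf step j x) (iterate_pmf gw j z)"
proof (induction j arbitrary: x z)
  case 0
  show ?case by (rule pmf_eqI_nn_integral) (simp add: nn_integral_conv_pmf)
next
  case (Suc j)
  show ?case
  proof (rule pmf_eqI_nn_integral)
    fix f :: "nat \<Rightarrow> ennreal"
    have "(\<integral>\<^sup>+y. f y \<partial>iterate_pmf step (Suc j) (x + z)) =
        (\<integral>\<^sup>+x1. \<integral>\<^sup>+z1. \<integral>\<^sup>+a. \<integral>\<^sup>+b. f (a + b) \<partial>iterate_pmf gw j z1 \<partial>iterate_pmf step j x1 \<partial>gw z \<partial>step x)"
      by (simp add: step_add nn_integral_conv_pmf Suc.IH)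
    also have "\<dots> = (\<integral>\<^sup>+x1. \<integral>\<^sup>+a. \<integral>\<^sup>+z1. \<integral>\<^sup>+b. f (a + b) \<partial>iterate_pmf gw j z1 \<partial>gw z \<partial>iterate_pmf step j x1 \<partial>step x)"
      by (subst nn_integral_pmf_swap) simp
    finally show "(\<integral>\<^sup>+y. f y \<partial>iterate_pmf step (Suc j) (x + z)) =
       (\<integral>\<^sup>+y. f y \<partial>conv_pmf (iterate_pmf step (Suc j) x) (iterate_pmf gw (Suc j) z))"
      by (simp add: nn_integral_conv_pmf)
  qed
qed

text \<open>Adding individuals can only raise the chain coupled as in \<open>step_add\<close>.\<close>

lemma stay_antimono: "stay u k (x + z) \<le> stay u k x"
proof (induction k arbitrary: x z)
  case (Suc k)
  have "stay u (Suc k) (x + z) =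
      (\<integral>\<^sup>+a. \<integral>\<^sup>+b. (if real (a + b) \<le> u then stay u k (a + b) else 0) \<partial>gw z \<partial>step x)"
    by (simp add: step_add nn_integral_conv_pmf)
  also have "\<dots> \<le> (\<integral>\<^sup>+a. \<integral>\<^sup>+b. (if real a \<le> u then stay u k a else 0) \<partial>gw z \<partial>step x)"
    using Suc.IH by (intro nn_integral_mono) auto
  also have "\<dots> = stay u (Suc k) x"
    by (simp add: measure_pmf.emeasure_space_1)
  finally show ?case .
qed simp

text \<open>Probability, at time \<open>j\<close> of the coupling, that the chain started from \<open>x\<close> is at most \<open>u\<close> but
  that adding the independent population descending from \<open>z\<close> lifts it above \<open>u\<close>.\<close>

definition lift_prob :: "real \<Rightarrow> nat \<Rightarrow> nat \<Rightarrow> nat \<Rightarrow> ennreal" where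
  "lift_prob u j x z =
     (\<integral>\<^sup>+a. \<integral>\<^sup>+b. (if real a \<le> u \<and> u < real (a + b) then 1 else 0)
        \<partial>iterate_pmf gw j z \<partial>iterate_pmf step j x)"

lemma lift_prob_Suc:
  "lift_prob u (Suc j) x z = (\<integral>\<^sup>+x1. \<integral>\<^sup>+z1. lift_prob u j x1 z1 \<partial>gw z \<partial>step x)"
proof -
  have "lift_prob u (Suc j) x z =
      (\<integral>\<^sup>+x1. \<integral>\<^sup>+a. \<integral>\<^sup>+z1. \<integral>\<^sup>+b. (if real a \<le> u \<and> u < real (a + b) then 1 else 0)
         \<partial>iterate_pmf gw j z1 \<partial>gw z \<partial>iterate_pmf step j x1 \<partial>step x)"
    by (simp add: lift_prob_def)
  also have "\<dots> = (\<integral>\<^sup>+x1. \<integral>\<^sup>+z1. lift_prob u j x1 z1 \<partial>gw z \<partial>step x)"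
    unfolding lift_prob_def by (subst nn_integral_pmf_swap) simp
  finally show ?thesis .
qed

text \<open>A union bound: if the smaller chain stays below \<open>u\<close> and the larger one does not, the
  lift happens at one of the times \<open>1, \<dots>, k\<close>.\<close>

lemma stay_le_stay_add:
  "stay u k x \<le> stay u k (x + z) + (\<Sum>j=1..k. lift_prob u j x z)"
proof (induction k arbitrary: x z)
  case (Suc k)
  have "stay u (Suc k) x = (\<integral>\<^sup>+a. \<integral>\<^sup>+b. (if real a \<le> u then stay u k a else 0) \<partial>gw z \<partial>step x)"
    by (simp add: measure_pmf.emeasure_space_1)
  also have "\<dots> \<le> (\<integral>\<^sup>+a. \<integral>\<^sup>+b. (if real (a + b) \<le> u then stay u k (a + b) else 0) +
      (lift_prob u 0 a b + (\<Sum>j=1..k. lift_prob u j a b)) \<partial>gw z \<partial>step x)"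
  proof (intro nn_integral_mono)
    fix a b
    show "(if real a \<le> u then stay u k a else 0) \<le> (if real (a + b) \<le> u then stay u k (a + b) else 0) +
      (lift_prob u 0 a b + (\<Sum>j=1..k. lift_prob u j a b))"
    proof (cases "real a \<le> u \<and> u < real (a + b)")
      case True
      then have "stay u k a \<le> lift_prob u 0 a b"
        by (simp add: lift_prob_def stay_below_le_1)
      with True show ?thesis
        by (simp add: add_increasing2)
    next
      case False
      then show ?thesis
        using Suc.IH[of a b] by (auto simp: add_increasing ac_simps intro: order_trans add_increasing2)
    qed
  qed
  also have "\<dots> = stay u (Suc k) (x + z) + (\<integral>\<^sup>+a. \<integral>\<^sup>+b. (\<Sum>j=0..k. lift_prob u j a b) \<partial>gw z \<partial>step x)"
    by (simp add: nn_integral_add step_add nn_integral_conv_pmf sum.atLeast_Suc_atMost)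
  also have "(\<integral>\<^sup>+a. \<integral>\<^sup>+b. (\<Sum>j=0..k. lift_prob u j a b) \<partial>gw z \<partial>step x) = (\<Sum>j=0..k. lift_prob u (Suc j) x z)"
    by (simp add: nn_integral_sum lift_prob_Suc)
  also have "\<dots> = (\<Sum>j=1..Suc k. lift_prob u j x z)"
    using sum.shift_bounds_cl_Suc_ivl[of "\<lambda>j. lift_prob u j x z" 0 k] by simp
  finally show ?case .
qed simp

end

section \<open>The stationary chain\<close>

locale stationary_branching_kernel = branching_kernel +
  fixes \<pi> :: "nat pmf" and \<mu> :: real
  assumes mean_offspring: "(\<integral>\<^sup>+x. ennreal (real x) \<partial>pA) = ennreal \<mu>"
    and mean_pos: "0 < \<mu>" and mean_less_1: "\<mu> < 1"
    and invariant: "bind_pmf \<pi> step = \<pi>"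
begin

lemma nn_integral_iterate_gw: "(\<integral>\<^sup>+y. ennreal (real y) \<partial>iterate_pmf gw j z) = ennreal (\<mu> ^ j * real z)"
proof (induction j arbitrary: z)
  case (Suc j)
  have "(\<integral>\<^sup>+y. ennreal (real y) \<partial>iterate_pmf gw (Suc j) z) = (\<integral>\<^sup>+y. ennreal (\<mu> ^ j) * ennreal (real y) \<partial>gw z)"
    using mean_pos by (simp add: Suc.IH ennreal_mult)
  also have "\<dots> = ennreal (\<mu> ^ j) * ennreal (\<mu> * real z)"
    using mean_pos by (simp add: nn_integral_cmult gw_def nn_integral_sum_iid_pmf[OF mean_offspring])
  also have "\<dots> = ennreal (\<mu> ^ Suc j * real z)"
    using mean_pos by (simp add: ennreal_mult[symmetric] mult_ac)
  finally show ?case .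
qed simp

lemma iterate_gw_tail_le:
  assumes "v > 0"
  shows "emeasure (iterate_pmf gw j z) {y. v \<le> real y} \<le> ennreal (\<mu> ^ j * real z / v)"
proof (rule emeasure_pmf_Markov[OF assms, where f = "\<lambda>y. ennreal (real y)"])
  show "(\<integral>\<^sup>+y. ennreal (real y) \<partial>iterate_pmf gw j z) \<le> ennreal (\<mu> ^ j * real z)"
    by (simp add: nn_integral_iterate_gw)
qed (use mean_pos in \<open>auto intro: ennreal_leI\<close>)

definition no_exceedance :: "real \<Rightarrow> nat \<Rightarrow> real" where
  "no_exceedance u k = enn2real (\<integral>\<^sup>+x. stay u k x \<partial>\<pi>)"

definition tail :: "real \<Rightarrow> real" where
  "tail v = measure_pmf.prob \<pi> {x. v < real x}"

lemma ennreal_no_exceedance: "ennreal (no_exceedance u k) = (\<integral>\<^sup>+x. stay u k x \<partial>\<pi>)"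
proof -
  have "(\<integral>\<^sup>+x. stay u k x \<partial>\<pi>) \<le> (\<integral>\<^sup>+x. 1 \<partial>\<pi>)"
    by (intro nn_integral_mono stay_below_le_1)
  then show ?thesis
    unfolding no_exceedance_def
    by (intro ennreal_enn2real) (auto simp: measure_pmf.emeasure_space_1 intro: le_less_trans[of _ 1])
qed

lemma no_exceedance_nonneg: "0 \<le> no_exceedance u k"
  by (simp add: no_exceedance_def)

lemma no_exceedance_0: "no_exceedance u 0 = 1"
  by (simp add: no_exceedance_def measure_pmf.emeasure_space_1)

lemma ennreal_tail: "ennreal (tail v) = emeasure \<pi> {x. v < real x}"
  by (simp add: tail_def measure_pmf.emeasure_eq_measure)

lemma tail_nonneg: "0 \<le> tail v" and tail_le_1: "tail v \<le> 1"
  by (simp_all add: tail_def)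

lemma tail_antimono: "v \<le> w \<Longrightarrow> tail w \<le> tail v"
  unfolding tail_def by (intro measure_pmf.finite_measure_mono) auto

lemma prob_interval: 
  assumes "v \<le> w"
  shows "emeasure \<pi> {x. v < real x \<and> real x \<le> w} = ennreal (tail v - tail w)"
proof -
  have eq: "{x. v < real x \<and> real x \<le> w} = {x. v < real x} - {x. w < real x}" by auto
  have "measure_pmf.prob \<pi> {x. v < real x \<and> real x \<le> w} = tail v - tail w"
    unfolding tail_def eq using assms by (intro measure_pmf.finite_measure_Diff) auto
  then show ?thesis by (simp add: measure_pmf.emeasure_eq_measure)
qed

lemma tail_tendsto_0: "(tail \<longlongrightarrow> 0) at_top"
proof -
  have "(\<lambda>n. measure_pmf.prob \<pi> {x. real n < real x}) \<longlonglongrightarrow> measure_pmf.prob \<pi> (\<Inter>n. {x. real n < real x})"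
    by (intro measure_pmf.finite_Lim_measure_decseq) (auto simp: decseq_def)
  also have "(\<Inter>n. {x::nat. real n < real x}) = {}" by auto
  finally have lim: "(\<lambda>n. tail (real n)) \<longlonglongrightarrow> 0" by (simp add: tail_def)
  show ?thesis
  proof (rule decreasing_tendsto)
    fix e :: real assume "0 < e"
    then obtain n where n: "tail (real n) < e"
      using order_tendstoD(2)[OF lim] by (auto simp: eventually_sequentially)
    show "\<forall>\<^sub>F v in at_top. tail v < e"
      using eventually_ge_at_top[of "real n"] by eventually_elim (rule le_less_trans[OF tail_antimono n])
  qed (simp add: tail_nonneg)
qed

text \<open>Invariance allows the window \<open>1, \<dots>, k\<close> to be read as \<open>0, \<dots>, k - 1\<close>; the decrement is then
  the probability of starting above \<open>u\<close> and staying below it afterwards.\<close>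

lemma no_exceedance_Suc:
  "ennreal (no_exceedance u k) = ennreal (no_exceedance u (Suc k)) +
     (\<integral>\<^sup>+x. (if u < real x then stay u k x else 0) \<partial>\<pi>)"
proof -
  have "ennreal (no_exceedance u (Suc k)) = (\<integral>\<^sup>+y. (if real y \<le> u then stay u k y else 0) \<partial>bind_pmf \<pi> step)"
    by (simp add: ennreal_no_exceedance)
  also have "\<dots> = (\<integral>\<^sup>+y. (if real y \<le> u then stay u k y else 0) \<partial>\<pi>)"
    by (simp add: invariant)
  finally show ?thesis
    by (simp add: ennreal_no_exceedance nn_integral_add[symmetric])
       (auto intro!: nn_integral_cong)
qed

lemma average_lift_prob:
  "(\<integral>\<^sup>+x. lift_prob u j x z \<partial>\<pi>) =
     (\<integral>\<^sup>+a. \<integral>\<^sup>+b. (if real a \<le> u \<and> u < real (a + b) then 1 else 0) \<partial>iterate_pmf gw j z \<partial>\<pi>)"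
proof -
  have "(\<integral>\<^sup>+x. lift_prob u j x z \<partial>\<pi>) =
     (\<integral>\<^sup>+a. \<integral>\<^sup>+b. (if real a \<le> u \<and> u < real (a + b) then 1 else 0) \<partial>iterate_pmf gw j z
       \<partial>bind_pmf \<pi> (iterate_pmf step j))"
    by (simp add: lift_prob_def)
  then show ?thesis by (simp add: bind_iterate_pmf_invariant[OF invariant])
qed

text \<open>If the lift occurs at time \<open>j\<close>, then either the stationary variable lies in \<open>(v, u]\<close> or the
  added population exceeds \<open>u - v\<close>.\<close>

lemma average_lift_prob_le:
  assumes "v \<le> u"
  shows "(\<integral>\<^sup>+x. lift_prob u j x z \<partial>\<pi>) \<le>
    ennreal (tail v - tail u) + emeasure (iterate_pmf gw j z) {y. u - v < real y}"
proof -
  have "(\<integral>\<^sup>+x. lift_prob u j x z \<partial>\<pi>) \<le>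
     (\<integral>\<^sup>+a. \<integral>\<^sup>+b. indicator {x. v < real x \<and> real x \<le> u} a + indicator {y. u - v < real y} b
        \<partial>iterate_pmf gw j z \<partial>\<pi>)"
    unfolding average_lift_prob by (intro nn_integral_mono) (auto simp: indicator_def)
  also have "\<dots> = emeasure \<pi> {x. v < real x \<and> real x \<le> u} + emeasure (iterate_pmf gw j z) {y. u - v < real y}"
    by (simp add: nn_integral_add measure_pmf.emeasure_space_1)
  finally show ?thesis by (simp add: prob_interval[OF assms])
qed

lemma lift_prob_0_le_survival: "lift_prob u j 0 z \<le> ennreal (\<mu> ^ j * real z)"
proof -
  have "lift_prob u j 0 z \<le> (\<integral>\<^sup>+a. \<integral>\<^sup>+b. indicator {y. 1 \<le> real y} b \<partial>iterate_pmf gw j z \<partial>iterate_pmf step j 0)"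
    unfolding lift_prob_def by (intro nn_integral_mono) (auto simp: indicator_def)
  also have "\<dots> = emeasure (iterate_pmf gw j z) {y. 1 \<le> real y}"
    by (simp add: measure_pmf.emeasure_space_1 del: of_nat_le_iff of_nat_1 real_of_nat_ge_one_iff)
  also have "\<dots> \<le> ennreal (\<mu> ^ j * real z)"
    using iterate_gw_tail_le[of 1 j z] by simp
  finally show ?thesis .
qed

text \<open>Here the sum of both parts of the coupling is the stationary chain itself, so a lift forces an
  exceedance of that chain.\<close>

lemma average_lift_prob_0_le: "(\<integral>\<^sup>+z. lift_prob u j 0 z \<partial>\<pi>) \<le> ennreal (tail u)"
proof -
  have "lift_prob u j 0 z \<le> (\<integral>\<^sup>+y. indicator {y. u < real y} y \<partial>iterate_pmf step j z)" for z
  proof -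
    have "lift_prob u j 0 z \<le> (\<integral>\<^sup>+a. \<integral>\<^sup>+b. indicator {y. u < real y} (a + b)
       \<partial>iterate_pmf gw j z \<partial>iterate_pmf step j 0)"
      unfolding lift_prob_def by (intro nn_integral_mono) (auto simp: indicator_def)
    then show ?thesis
      using iterate_step_add[of j 0 z] by (simp only: nn_integral_conv_pmf add_0)
  qed
  then have "(\<integral>\<^sup>+z. lift_prob u j 0 z \<partial>\<pi>) \<le>
      (\<integral>\<^sup>+z. (\<integral>\<^sup>+y. indicator {y. u < real y} y \<partial>iterate_pmf step j z) \<partial>\<pi>)"
    by (intro nn_integral_mono)
  also have "\<dots> = (\<integral>\<^sup>+y. indicator {y. u < real y} y \<partial>bind_pmf \<pi> (iterate_pmf step j))"
    by (simp only: nn_integral_bind_pmf)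
  finally show ?thesis by (simp add: bind_iterate_pmf_invariant[OF invariant] ennreal_tail)
qed

lemma sum_mean_powers_le: "(\<Sum>j=Suc l..k. \<mu> ^ j) \<le> \<mu> ^ l / (1 - \<mu>)"
proof -
  have "(\<Sum>j=Suc l..k. \<mu> ^ j) \<le> (\<Sum>j. \<mu> ^ (j + l))"
  proof (cases "l \<le> k")
    case True
    have "(\<Sum>j=Suc l..k. \<mu> ^ j) \<le> (\<Sum>j=l..k. \<mu> ^ j)"
      using mean_pos by (intro sum_mono2) auto
    also have "\<dots> = (\<Sum>j<Suc k - l. \<mu> ^ (j + l))"
      using True by (intro sum.reindex_bij_witness[of _ "\<lambda>j. j + l" "\<lambda>j. j - l"]) auto
    also have "\<dots> \<le> (\<Sum>j. \<mu> ^ (j + l))"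
      using mean_pos mean_less_1 by (intro sum_le_suminf) (auto intro!: summable_ignore_initial_segment summable_geometric)
    finally show ?thesis .
  next
    case False
    then show ?thesis
      using mean_pos mean_less_1 by (auto intro!: suminf_nonneg summable_ignore_initial_segment summable_geometric)
  qed
  also have "(\<Sum>j. \<mu> ^ (j + l)) = \<mu> ^ l / (1 - \<mu>)"
    using mean_pos mean_less_1 suminf_mult[of "\<lambda>j. \<mu> ^ j" "\<mu> ^ l"] suminf_geometric[of \<mu>]
    by (simp add: power_add mult.commute summable_geometric)
  finally show ?thesis .
qed

lemma sum_split_at_le:
  fixes f :: "nat \<Rightarrow> ennreal"
  assumes "\<And>j. f j \<le> ennreal (\<mu> ^ j * C)" "C \<ge> 0"
  shows "(\<Sum>j=1..k. f j) \<le> (\<Sum>j=1..l. f j) + ennreal (C * \<mu> ^ l / (1 - \<mu>))"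
proof -
  have "(\<Sum>j=1..k. f j) \<le> (\<Sum>j\<in>{1..l} \<union> {Suc l..k}. f j)"
    by (intro sum_mono2) auto
  also have "\<dots> = (\<Sum>j=1..l. f j) + (\<Sum>j=Suc l..k. f j)"
    by (intro sum.union_disjoint) auto
  also have "(\<Sum>j=Suc l..k. f j) \<le> (\<Sum>j=Suc l..k. ennreal (\<mu> ^ j * C))"
    by (intro sum_mono assms)
  also have "\<dots> = ennreal ((\<Sum>j=Suc l..k. \<mu> ^ j) * C)"
    using mean_pos assms(2) by (subst sum_ennreal) (auto simp: sum_distrib_right)
  also have "\<dots> \<le> ennreal (C * \<mu> ^ l / (1 - \<mu>))"
    using mult_right_mono[OF sum_mean_powers_le assms(2), of l k] by (intro ennreal_leI) (simp add: mult.commute)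
  finally show ?thesis by (simp add: add_left_mono)
qed

text \<open>Compare the chain from \<open>0\<close> with the one from \<open>z\<close>, averaged over the stationary law of \<open>z\<close>.
  States \<open>z > C\<close> are discarded; for the others the first \<open>l\<close> lifts are bounded by exceedances of the
  stationary chain and the later ones by the survival of the added population.\<close>

lemma stay_0_le_no_exceedance_bound:
  assumes "C \<ge> 0"
  shows "stay u k 0 \<le> ennreal (no_exceedance u k + (tail C + real l * tail u + C * \<mu> ^ l / (1 - \<mu>)))"
proof -
  have "stay u k 0 \<le> stay u k z + (indicator {z. C < real z} z + ((\<Sum>j=1..l. lift_prob u j 0 z) + ennreal (C * \<mu> ^ l / (1 - \<mu>))))" for z
  proof (cases "real z \<le> C")
    case True
    have "(\<Sum>j=1..k. lift_prob u j 0 z) \<le> (\<Sum>j=1..l. lift_prob u j 0 z) + ennreal (C * \<mu> ^ l / (1 - \<mu>))"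
    proof (rule sum_split_at_le)
      fix j
      have "ennreal (\<mu> ^ j * real z) \<le> ennreal (\<mu> ^ j * C)"
        using True mean_pos by (intro ennreal_leI mult_left_mono) auto
      then show "lift_prob u j 0 z \<le> ennreal (\<mu> ^ j * C)"
        using lift_prob_0_le_survival[of u j z] by (rule order_trans[rotated])
    qed fact
    then have "stay u k z + (\<Sum>j=1..k. lift_prob u j 0 z) \<le> stay u k z + ((\<Sum>j=1..l. lift_prob u j 0 z) + ennreal (C * \<mu> ^ l / (1 - \<mu>)))"
      by (rule add_left_mono)
    from order_trans[OF stay_le_stay_add[of u k 0 z, unfolded add_0] this] True
    show ?thesis by simp
  next
    case False
    then show ?thesis using stay_below_le_1[of step u k 0]
      by (auto simp: add_increasing add_increasing2)
  qed
  then have "(\<integral>\<^sup>+z. stay u k 0 \<partial>\<pi>) \<le> (\<integral>\<^sup>+z. stay u k z + (indicator {z. C < real z} z +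
      ((\<Sum>j=1..l. lift_prob u j 0 z) + ennreal (C * \<mu> ^ l / (1 - \<mu>)))) \<partial>\<pi>)"
    by (intro nn_integral_mono)
  also have "\<dots> = ennreal (no_exceedance u k) + (ennreal (tail C) +
      ((\<Sum>j=1..l. \<integral>\<^sup>+z. lift_prob u j 0 z \<partial>\<pi>) + ennreal (C * \<mu> ^ l / (1 - \<mu>))))"
    by (simp add: nn_integral_add nn_integral_sum ennreal_no_exceedance ennreal_tail measure_pmf.emeasure_space_1)
  also have "\<dots> \<le> ennreal (no_exceedance u k) + (ennreal (tail C) +
      ((\<Sum>j=1..l. ennreal (tail u)) + ennreal (C * \<mu> ^ l / (1 - \<mu>))))"
    by (intro add_left_mono add_right_mono sum_mono average_lift_prob_0_le)
  also have "(\<Sum>j=1..l. ennreal (tail u)) = ennreal (real l * tail u)"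
    by (simp add: ennreal_mult tail_nonneg ennreal_of_nat_eq_real_of_nat)
  finally show ?thesis
    using assms mean_pos mean_less_1 no_exceedance_nonneg tail_nonneg
    by (simp add: measure_pmf.emeasure_space_1 add.assoc flip: ennreal_plus)
qed

lemma eventually_stay_0_le:
  assumes "\<delta> > 0"
  shows "\<forall>\<^sub>F u in at_top. \<forall>k. stay u k 0 \<le> ennreal (no_exceedance u k + \<delta>)"
proof -
  obtain C where C: "C \<ge> 0" "tail C < \<delta> / 3"
  proof -
    have "\<forall>\<^sub>F C in at_top. C \<ge> 0 \<and> tail C < \<delta> / 3"
      using order_tendstoD(2)[OF tail_tendsto_0, of "\<delta> / 3"] assms
      by (intro eventually_conj eventually_ge_at_top) auto
    then show ?thesis using that by (auto simp: eventually_at_top_linorder)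
  qed
  obtain l where l: "C * \<mu> ^ l / (1 - \<mu>) < \<delta> / 3"
  proof -
    have "(\<lambda>l. C * \<mu> ^ l / (1 - \<mu>)) \<longlonglongrightarrow> C * 0 / (1 - \<mu>)"
      using mean_pos mean_less_1 by (intro tendsto_intros LIMSEQ_realpow_zero) auto
    then have "\<forall>\<^sub>F l in sequentially. C * \<mu> ^ l / (1 - \<mu>) < \<delta> / 3"
      using assms by (intro order_tendstoD(2)) auto
    then show ?thesis using that by (auto simp: eventually_sequentially)
  qed
  have "((\<lambda>u. real l * tail u) \<longlongrightarrow> real l * 0) at_top"
    by (intro tendsto_intros tail_tendsto_0)
  then have "\<forall>\<^sub>F u in at_top. real l * tail u < \<delta> / 3"
    using assms by (intro order_tendstoD(2)) auto
  then show ?thesis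
  proof eventually_elim
    case (elim u)
    show ?case
    proof
      fix k
      have "ennreal (no_exceedance u k + (tail C + real l * tail u + C * \<mu> ^ l / (1 - \<mu>))) \<le> ennreal (no_exceedance u k + \<delta>)"
        using C(2) l elim by (intro ennreal_leI) linarith
      then show "stay u k 0 \<le> ennreal (no_exceedance u k + \<delta>)"
        using stay_0_le_no_exceedance_bound[OF C(1)] by (rule order_trans[rotated])
    qed
  qed
qed

section \<open>Law of large numbers for one reproduction step\<close>

lemma integrable_offspring: "integrable pA (\<lambda>x. real x)"
  by (rule integrableI_nonneg) (auto simp: mean_offspring)

lemma expectation_offspring: "measure_pmf.expectation pA (\<lambda>x. real x) = \<mu>"
  using mean_offspring mean_pos by (simp add: integral_eq_nn_integral)

text \<open>The difference quotients \<open>(1 - E exp (-s A)) / s\<close> tend to \<open>E A\<close> as \<open>s\<close> decreases to \<open>0\<close>, by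
  dominated convergence along \<open>s = 1 / (n + 1)\<close>.\<close>

lemma laplace_offspring_le:
  assumes "\<nu> < \<mu>"
  shows "\<exists>s>0. (\<integral>\<^sup>+y. ennreal (exp (- (s * real y))) \<partial>pA) \<le> ennreal (exp (- (s * \<nu>)))"
proof -
  define f where "f n x = (1 - exp (- (real x / real (Suc n)))) * real (Suc n)" for n x
  have f_lim: "(\<lambda>n. f n x) \<longlonglongrightarrow> real x" for x
  proof -
    have "((\<lambda>y. (1 - exp (- (real x / y))) * y) \<longlongrightarrow> real x) at_top"
      by real_asymp
    moreover have "filterlim (\<lambda>n. real (Suc n)) at_top sequentially"
      by real_asymp
    ultimately show ?thesis
      unfolding f_def by (rule filterlim_compose)
  qed
  have f_bound: "0 \<le> f n x \<and> f n x \<le> real x" for n x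
  proof -
    have "1 - exp (- (real x / real (Suc n))) \<le> real x / real (Suc n)"
      using exp_ge_add_one_self[of "- (real x / real (Suc n))"] by linarith
    then have "f n x \<le> real x / real (Suc n) * real (Suc n)"
      unfolding f_def by (intro mult_right_mono) auto
    then show ?thesis by (simp add: f_def)
  qed
  have "(\<lambda>n. measure_pmf.expectation pA (f n)) \<longlonglongrightarrow> measure_pmf.expectation pA (\<lambda>x. real x)"
    by (rule integral_dominated_convergence[where w = "\<lambda>x. real x"])
       (use f_lim f_bound integrable_offspring in auto)
  then have "\<forall>\<^sub>F n in sequentially. \<nu> < measure_pmf.expectation pA (f n)"
    using assms by (intro order_tendstoD(1)) (auto simp: expectation_offspring)
  then obtain n where n: "\<nu> < measure_pmf.expectation pA (f n)"
    by (auto simp: eventually_sequentially)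
  define s where "s = 1 / real (Suc n)"
  have s: "s > 0" by (simp add: s_def)
  have int_f: "integrable pA (f n)"
    using f_bound by (intro Bochner_Integration.integrable_bound[OF integrable_offspring]) auto
  have exp_eq: "exp (- (s * real x)) = 1 - s * f n x" for x
    by (simp add: f_def s_def field_simps)
  have "(\<integral>\<^sup>+y. ennreal (exp (- (s * real y))) \<partial>pA) = ennreal (measure_pmf.expectation pA (\<lambda>y. exp (- (s * real y))))"
    using s by (intro nn_integral_eq_integral measure_pmf.integrable_const_bound[where B = 1]) auto
  also have "measure_pmf.expectation pA (\<lambda>y. exp (- (s * real y))) = 1 - s * measure_pmf.expectation pA (f n)"
    using int_f by (simp add: exp_eq)
  also have "\<dots> \<le> 1 - s * \<nu>"
    using n s by simp
  also have "\<dots> \<le> exp (- (s * \<nu>))"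
    using exp_ge_add_one_self[of "- (s * \<nu>)"] by linarith
  finally show ?thesis
    using s by (auto intro: ennreal_leI)
qed

text \<open>Chernoff's bound for the lower tail: nonnegative summands have a finite Laplace transform, whatever
  their upper tail is.\<close>

lemma gw_lower_deviation:
  assumes "\<nu> < \<mu>"
  shows "\<exists>r>0. \<forall>z. emeasure (gw z) {y. real y \<le> \<nu> * real z} \<le> ennreal (exp (- (r * real z)))"
proof -
  \<comment> \<open>The midpoint of \<open>\<nu>\<close> and \<open>\<mu>\<close> leaves half of the gap as exponential rate.\<close>
  obtain s where s: "s > 0" "(\<integral>\<^sup>+y. ennreal (exp (- (s * real y))) \<partial>pA) \<le> ennreal (exp (- (s * ((\<mu> + \<nu>) / 2))))"
    using laplace_offspring_le[of "(\<mu> + \<nu>) / 2"] assms by auto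
  have exp_power: "ennreal (exp a) * ennreal (exp b) ^ z = ennreal (exp (a + real z * b))" for a b z
    by (simp add: ennreal_power ennreal_mult[symmetric] exp_add exp_of_nat_mult)
  have "emeasure (gw z) {y. real y \<le> \<nu> * real z} \<le> ennreal (exp (- (s * (\<mu> - \<nu>) / 2 * real z)))" for z
  proof -
    have "emeasure (gw z) {y. real y \<le> \<nu> * real z} = (\<integral>\<^sup>+y. indicator {y. real y \<le> \<nu> * real z} y \<partial>gw z)"
      by simp
    also have "\<dots> \<le> (\<integral>\<^sup>+y. ennreal (exp (s * (\<nu> * real z))) * ennreal (exp (- (s * real y))) \<partial>gw z)"
      using s(1) by (intro nn_integral_mono) (auto simp: indicator_def ennreal_mult[symmetric] simp flip: exp_add)
    also have "\<dots> = ennreal (exp (s * (\<nu> * real z))) * (\<integral>\<^sup>+y. ennreal (exp (- (s * real y))) \<partial>pA) ^ z"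
      by (simp add: nn_integral_cmult gw_def nn_integral_power_sum_iid_pmf)
    also have "\<dots> \<le> ennreal (exp (s * (\<nu> * real z))) * ennreal (exp (- (s * ((\<mu> + \<nu>) / 2)))) ^ z"
      by (intro mult_left_mono power_mono s) auto
    also have "\<dots> = ennreal (exp (s * (\<nu> * real z) + real z * (- (s * ((\<mu> + \<nu>) / 2)))))"
      by (rule exp_power)
    also have "s * (\<nu> * real z) + real z * (- (s * ((\<mu> + \<nu>) / 2))) = - (s * (\<mu> - \<nu>) / 2 * real z)"
      by (simp add: field_simps)
    finally show ?thesis .
  qed
  then show ?thesis
    using s(1) assms by (intro exI[of _ "s * (\<mu> - \<nu>) / 2"]) auto
qed

lemma eventually_gw_not_small:
  assumes "\<epsilon> > 0" "\<delta> > 0"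
  shows "\<forall>\<^sub>F u in at_top. \<forall>z. (1 + \<epsilon>) * u / \<mu> \<le> real z \<longrightarrow> emeasure (gw z) {y. real y \<le> u} \<le> ennreal \<delta>"
proof -
  obtain r where r: "r > 0" "\<And>z. emeasure (gw z) {y. real y \<le> \<mu> / (1 + \<epsilon>) * real z} \<le> ennreal (exp (- (r * real z)))"
    using gw_lower_deviation[of "\<mu> / (1 + \<epsilon>)"] assms mean_pos by (auto simp: field_simps)
  have "((\<lambda>u. exp (- (\<kappa> * u))) \<longlongrightarrow> 0) at_top" if "\<kappa> > 0" for \<kappa> :: real
    using that by real_asymp
  from this[of "r * ((1 + \<epsilon>) / \<mu>)"] have "((\<lambda>u. exp (- (r * ((1 + \<epsilon>) / \<mu>) * u))) \<longlongrightarrow> 0) at_top"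
    using r assms mean_pos by simp
  then have "\<forall>\<^sub>F u in at_top. exp (- (r * ((1 + \<epsilon>) / \<mu>) * u)) < \<delta>"
    using assms by (intro order_tendstoD(2)) auto
  then show ?thesis
  proof eventually_elim
    case (elim u)
    show ?case
    proof (intro allI impI)
      fix z assume z: "(1 + \<epsilon>) * u / \<mu> \<le> real z"
      have "u \<le> \<mu> / (1 + \<epsilon>) * real z"
        using z assms mean_pos by (simp add: field_simps)
      then have "emeasure (gw z) {y. real y \<le> u} \<le> emeasure (gw z) {y. real y \<le> \<mu> / (1 + \<epsilon>) * real z}"
        by (intro emeasure_mono) auto
      also have "\<dots> \<le> ennreal (exp (- (r * real z)))" by (rule r)
      also have "\<dots> \<le> ennreal \<delta>"
      proof (intro ennreal_leI)
        have "r * ((1 + \<epsilon>) * u / \<mu>) \<le> r * real z"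
          using z r(1) by (intro mult_left_mono) auto
        then have "exp (- (r * real z)) \<le> exp (- (r * ((1 + \<epsilon>) / \<mu>) * u))"
          by (simp add: mult_ac)
        with elim show "exp (- (r * real z)) \<le> \<delta>" by linarith
      qed
      finally show "emeasure (gw z) {y. real y \<le> u} \<le> ennreal \<delta>" .
    qed
  qed
qed

text \<open>Both sides are the means of the positive and the negative part of the centred sum. The identity
  turns control of lower deviations into control of upper ones.\<close>

lemma gw_mean_excess:
  "(\<integral>\<^sup>+y. ennreal (real y - \<mu> * real z) \<partial>gw z) = (\<integral>\<^sup>+y. ennreal (\<mu> * real z - real y) \<partial>gw z)"
proof -
  have "ennreal (\<mu> * real z) + (\<integral>\<^sup>+y. ennreal (real y - \<mu> * real z) \<partial>gw z) =
      (\<integral>\<^sup>+y. ennreal (\<mu> * real z) + ennreal (real y - \<mu> * real z) \<partial>gw z)"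
    by (simp add: nn_integral_add measure_pmf.emeasure_space_1)
  also have "\<dots> = (\<integral>\<^sup>+y. ennreal (real y) + ennreal (\<mu> * real z - real y) \<partial>gw z)"
  proof (rule nn_integral_cong)
    fix y
    show "ennreal (\<mu> * real z) + ennreal (real y - \<mu> * real z) = ennreal (real y) + ennreal (\<mu> * real z - real y)"
      using mean_pos by (cases "real y \<le> \<mu> * real z") (auto simp: ennreal_neg simp flip: ennreal_plus)
  qed
  also have "\<dots> = ennreal (\<mu> * real z) + (\<integral>\<^sup>+y. ennreal (\<mu> * real z - real y) \<partial>gw z)"
    using nn_integral_sum_iid_pmf[OF mean_offspring, of z] mean_pos
    by (simp add: nn_integral_add gw_def)
  finally show ?thesis by (simp add: ennreal_add_left_cancel)
qed

text \<open>The negative part is at most \<open>\<eta> z\<close> unless the sum is below \<open>(\<mu> - \<eta>) z\<close>, and then at most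
  \<open>\<mu> z\<close>; the exponential bound on the latter event makes its contribution bounded in \<open>z\<close>.\<close>

lemma gw_mean_excess_le:
  assumes "0 < \<eta>"
  shows "\<exists>C\<ge>0. \<forall>z. (\<integral>\<^sup>+y. ennreal (real y - \<mu> * real z) \<partial>gw z) \<le> ennreal (\<eta> * real z + C)"
proof -
  define \<nu> where "\<nu> = \<mu> - \<eta>"
  obtain r where r: "r > 0" "\<And>z. emeasure (gw z) {y. real y \<le> \<nu> * real z} \<le> ennreal (exp (- (r * real z)))"
    using gw_lower_deviation[of \<nu>] assms by (auto simp: \<nu>_def)
  have "(\<integral>\<^sup>+y. ennreal (real y - \<mu> * real z) \<partial>gw z) \<le> ennreal (\<eta> * real z + \<mu> / r)" for z
  proof -
    have "(\<integral>\<^sup>+y. ennreal (\<mu> * real z - real y) \<partial>gw z) \<le>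
        (\<integral>\<^sup>+y. ennreal (\<eta> * real z) + ennreal (\<mu> * real z) * indicator {y. real y \<le> \<nu> * real z} y \<partial>gw z)"
    proof (intro nn_integral_mono)
      fix y
      show "ennreal (\<mu> * real z - real y) \<le> ennreal (\<eta> * real z) + ennreal (\<mu> * real z) * indicator {y. real y \<le> \<nu> * real z} y"
        using mean_pos assms
        by (cases "real y \<le> \<nu> * real z")
           (auto simp: \<nu>_def algebra_simps intro: ennreal_leI add_increasing)
    qed
    also have "\<dots> = ennreal (\<eta> * real z) + ennreal (\<mu> * real z) * emeasure (gw z) {y. real y \<le> \<nu> * real z}"
      by (simp add: nn_integral_add nn_integral_cmult measure_pmf.emeasure_space_1)
    also have "\<dots> \<le> ennreal (\<eta> * real z) + ennreal (\<mu> * real z) * ennreal (exp (- (r * real z)))"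
      by (intro add_left_mono mult_left_mono r) simp
    also have "\<dots> = ennreal (\<eta> * real z + \<mu> * (real z * exp (- (r * real z))))"
      using mean_pos assms by (simp add: ennreal_mult[symmetric] mult.assoc flip: ennreal_plus)
    also have "\<dots> \<le> ennreal (\<eta> * real z + \<mu> / r)"
    proof (intro ennreal_leI add_left_mono)
      have "r * real z \<le> exp (r * real z)"
        using exp_ge_add_one_self[of "r * real z"] by linarith
      then have "real z * exp (- (r * real z)) \<le> 1 / r"
        using r(1) by (simp add: exp_minus field_simps)
      then show "\<mu> * (real z * exp (- (r * real z))) \<le> \<mu> / r"
        using mult_left_mono[of _ "1 / r" \<mu>] mean_pos by simp
    qed
    finally show ?thesis by (simp add: gw_mean_excess)
  qed
  then show ?thesis
    using r(1) mean_pos by (intro exI[of _ "\<mu> / r"]) auto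
qed

text \<open>Markov's inequality for the excess over the mean, which has to reach \<open>(b - a) u\<close>, whereas its
  mean is of smaller order than \<open>u\<close>.\<close>

lemma eventually_gw_not_large:
  assumes "0 < a" "a < b" "\<delta> > 0"
  shows "\<forall>\<^sub>F u in at_top. \<forall>z. \<mu> * real z \<le> a * u \<longrightarrow> emeasure (gw z) {y. b * u < real y} \<le> ennreal \<delta>"
proof -
  define \<eta> where "\<eta> = \<delta> * (b - a) * \<mu> / (2 * a)"
  have eta: "\<eta> > 0" using assms mean_pos by (simp add: \<eta>_def)
  obtain C where C: "C \<ge> 0" "\<And>z. (\<integral>\<^sup>+y. ennreal (real y - \<mu> * real z) \<partial>gw z) \<le> ennreal (\<eta> * real z + C)"
    using gw_mean_excess_le[OF eta] by auto
  show ?thesis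
    using eventually_gt_at_top[of 0] eventually_ge_at_top[of "2 * C / (\<delta> * (b - a))"]
  proof eventually_elim
    case (elim u)
    show ?case
    proof (intro allI impI)
      fix z assume z: "\<mu> * real z \<le> a * u"
      define w where "w = (b - a) * u"
      have w: "w > 0" using assms elim by (simp add: w_def)
      have le: "\<eta> * real z + C \<le> \<delta> * w"
      proof -
        have "\<eta> * real z = \<delta> * (b - a) / (2 * a) * (\<mu> * real z)" by (simp add: \<eta>_def)
        also have "\<dots> \<le> \<delta> * (b - a) / (2 * a) * (a * u)"
          using z assms by (intro mult_left_mono) auto
        also have "\<dots> = \<delta> * w / 2" using assms by (simp add: w_def)
        finally have 1: "\<eta> * real z \<le> \<delta> * w / 2" .
        have "C \<le> \<delta> * w / 2" using elim(2) assms by (simp add: w_def field_simps)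
        with 1 show ?thesis by linarith
      qed
      have "emeasure (gw z) {y. b * u < real y} \<le> ennreal (\<delta> * w / w)"
      proof (rule emeasure_pmf_Markov[OF w, where f = "\<lambda>y. ennreal (real y - \<mu> * real z)"])
        show "(\<integral>\<^sup>+y. ennreal (real y - \<mu> * real z) \<partial>gw z) \<le> ennreal (\<delta> * w)"
          using C(2) ennreal_leI[OF le] by (rule order_trans)
        show "ennreal w \<le> ennreal (real y - \<mu> * real z)" if "y \<in> {y. b * u < real y}" for y
          using z that by (intro ennreal_leI) (simp add: w_def algebra_simps)
      qed (use w assms in simp)
      then show "emeasure (gw z) {y. b * u < real y} \<le> ennreal \<delta>"
        using w by simp
    qed
  qed
qed

text \<open>The first generation drops below \<open>c' u\<close> by the law of large numbers; from there each further
  generation has mean at most \<open>\<mu> c' u\<close> and rises above \<open>c' u\<close> with probability at most \<open>\<delta>\<close>.\<close>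

lemma eventually_iterate_gw_not_large:
  assumes "0 < c" "c < c'" "\<delta> > 0"
  shows "\<forall>\<^sub>F u in at_top. \<forall>z j. \<mu> * real z \<le> c * u \<longrightarrow> 1 \<le> j \<longrightarrow>
    emeasure (iterate_pmf gw j z) {y. c' * u < real y} \<le> ennreal (real j * \<delta>)"
proof -
  have pos: "0 < \<mu> * c'" "\<mu> * c' < c'" using assms mean_pos mean_less_1 by auto
  show ?thesis
    using eventually_gw_not_large[OF assms] eventually_gw_not_large[OF pos assms(3)]
  proof eventually_elim
    case (elim u)
    have first_step: "emeasure (iterate_pmf gw (Suc j) z) {x. c' * u < real x} \<le> ennreal (real (Suc j) * \<delta>)"
      if "emeasure (gw z) {x. c' * u < real x} \<le> ennreal \<delta>"
        and later: "\<And>y. real y \<le> c' * u \<Longrightarrow> emeasure (iterate_pmf gw j y) {x. c' * u < real x} \<le> ennreal (real j * \<delta>)"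
      for j z
    proof -
      have "emeasure (iterate_pmf gw (Suc j) z) {x. c' * u < real x} =
          (\<integral>\<^sup>+y. emeasure (iterate_pmf gw j y) {x. c' * u < real x} \<partial>gw z)" by simp
      also have "\<dots> \<le> (\<integral>\<^sup>+y. indicator {x. c' * u < real x} y + ennreal (real j * \<delta>) \<partial>gw z)"
        by (intro nn_integral_mono)
           (auto simp: indicator_def measure_pmf.emeasure_le_1 intro!: add_increasing2 later)
      also have "\<dots> = emeasure (gw z) {x. c' * u < real x} + ennreal (real j * \<delta>)"
        by (simp add: nn_integral_add measure_pmf.emeasure_space_1)
      also have "\<dots> \<le> ennreal \<delta> + ennreal (real j * \<delta>)"
        using that(1) by (rule add_right_mono)
      also have "\<dots> = ennreal (real (Suc j) * \<delta>)"
        using assms by (simp add: algebra_simps flip: ennreal_plus)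
      finally show ?thesis .
    qed
    have bound: "emeasure (iterate_pmf gw j y) {x. c' * u < real x} \<le> ennreal (real j * \<delta>)" if "real y \<le> c' * u" for j y
      using that
    proof (induction j arbitrary: y)
      case (Suc j)
      show ?case
      proof (rule first_step[OF _ Suc.IH])
        show "emeasure (gw y) {x. c' * u < real x} \<le> ennreal \<delta>"
          using elim(2) Suc.prems mean_pos by (auto simp: mult.assoc)
      qed
    qed simp
    show ?case
    proof (intro allI impI)
      fix z j assume z: "\<mu> * real z \<le> c * u" and j: "1 \<le> (j::nat)"
      then obtain i where i: "j = Suc i" by (cases j) auto
      show "emeasure (iterate_pmf gw j z) {x. c' * u < real x} \<le> ennreal (real j * \<delta>)"
        unfolding i by (rule first_step[OF _ bound]) (use elim(1) z in auto)
    qed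
  qed
qed

section \<open>Decrements of the non-exceedance probabilities\<close>

text \<open>Compare the stationary chain with the chain to which \<open>z\<close> individuals have been added. At the first
  \<open>l\<close> times the added population is of the order of \<open>u\<close>, but mostly below \<open>c' u\<close>, and then a lift
  needs a stationary value above \<open>(1 - c') u\<close>. At later times it exceeds \<open>\<epsilon> u\<close> with summably small
  probability, and otherwise a lift needs a stationary value in \<open>((1 - \<epsilon>) u, u]\<close>.\<close>

lemma no_exceedance_le_stay_bound:
  assumes "0 < c" "c < c'" "c' < 1" "0 < \<epsilon>" "\<epsilon> < 1" "0 < u" "0 \<le> \<delta>"
    and z: "\<mu> * real z \<le> c * u"
    and small: "\<And>j. 1 \<le> j \<Longrightarrow> emeasure (iterate_pmf gw j z) {y. c' * u < real y} \<le> ennreal (real j * \<delta>)"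
  shows "ennreal (no_exceedance u k) \<le> stay u k z +
    ennreal (real l * (tail ((1 - c') * u) + real l * \<delta>) + real k * (tail ((1 - \<epsilon>) * u) - tail u)
      + c / (\<mu> * \<epsilon>) * \<mu> ^ l / (1 - \<mu>))"
proof -
  define D where "D = tail ((1 - \<epsilon>) * u) - tail u"
  have D: "D \<ge> 0" using assms by (simp add: D_def tail_antimono mult_left_le_one_le)
  let ?a = "\<lambda>j. \<integral>\<^sup>+x. lift_prob u j x z \<partial>\<pi>"
  have early: "?a j \<le> ennreal (tail ((1 - c') * u) + real l * \<delta>)" if "j \<in> {1..l}" for j
  proof -
    have "?a j \<le> ennreal (tail ((1 - c') * u) - tail u) + emeasure (iterate_pmf gw j z) {y. u - (1 - c') * u < real y}"
      using assms by (intro average_lift_prob_le) (simp add: mult_left_le_one_le)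
    also have "u - (1 - c') * u = c' * u" by (simp add: algebra_simps)
    also have "ennreal (tail ((1 - c') * u) - tail u) + emeasure (iterate_pmf gw j z) {y. c' * u < real y}
        \<le> ennreal (tail ((1 - c') * u)) + ennreal (real l * \<delta>)"
    proof (intro add_mono)
      show "ennreal (tail ((1 - c') * u) - tail u) \<le> ennreal (tail ((1 - c') * u))"
        by (intro ennreal_leI) (simp add: tail_nonneg)
      show "emeasure (iterate_pmf gw j z) {y. c' * u < real y} \<le> ennreal (real l * \<delta>)"
        using that assms by (intro order_trans[OF small] ennreal_leI mult_right_mono) auto
    qed
    finally show ?thesis using assms by (simp add: tail_nonneg)
  qed
  have late: "?a j \<le> ennreal (D + \<mu> ^ j * (c / (\<mu> * \<epsilon>)))" for j
  proof -
    have "?a j \<le> ennreal D + emeasure (iterate_pmf gw j z) {y. u - (1 - \<epsilon>) * u < real y}"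
      unfolding D_def using assms by (intro average_lift_prob_le) (simp add: mult_left_le_one_le)
    also have "u - (1 - \<epsilon>) * u = \<epsilon> * u" by (simp add: algebra_simps)
    also have "emeasure (iterate_pmf gw j z) {y. \<epsilon> * u < real y} \<le> emeasure (iterate_pmf gw j z) {y. \<epsilon> * u \<le> real y}"
      by (intro emeasure_mono) auto
    also have "\<dots> \<le> ennreal (\<mu> ^ j * real z / (\<epsilon> * u))"
      using assms by (intro iterate_gw_tail_le) simp
    also have "\<dots> \<le> ennreal (\<mu> ^ j * (c / (\<mu> * \<epsilon>)))"
    proof (intro ennreal_leI)
      have "real z / (\<epsilon> * u) \<le> c / (\<mu> * \<epsilon>)"
        using z assms mean_pos by (simp add: field_simps)
      then show "\<mu> ^ j * real z / (\<epsilon> * u) \<le> \<mu> ^ j * (c / (\<mu> * \<epsilon>))"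
        using mult_left_mono[of _ _ "\<mu> ^ j"] mean_pos by fastforce
    qed
    finally show ?thesis using D assms mean_pos by (simp add: add_left_mono)
  qed
  have "ennreal (no_exceedance u k) \<le> (\<integral>\<^sup>+x. stay u k z + (\<Sum>j=1..k. lift_prob u j x z) \<partial>\<pi>)"
    unfolding ennreal_no_exceedance
  proof (intro nn_integral_mono)
    fix x
    have "stay u k (x + z) \<le> stay u k z"
      using stay_antimono[of u k z x] by (simp add: add.commute)
    then show "stay u k x \<le> stay u k z + (\<Sum>j=1..k. lift_prob u j x z)"
      using stay_le_stay_add[of u k x z] by (meson add_right_mono order_trans)
  qed
  also have "\<dots> = stay u k z + (\<Sum>j=1..k. ?a j)"
    by (simp add: nn_integral_add nn_integral_sum measure_pmf.emeasure_space_1)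
  also have "(\<Sum>j=1..k. ?a j) \<le> (\<Sum>j\<in>{1..l} \<union> {Suc l..k}. ?a j)"
    by (intro sum_mono2) auto
  also have "\<dots> = (\<Sum>j=1..l. ?a j) + (\<Sum>j=Suc l..k. ?a j)"
    by (intro sum.union_disjoint) auto
  also have "\<dots> \<le> (\<Sum>j=1..l. ennreal (tail ((1 - c') * u) + real l * \<delta>)) +
      (\<Sum>j=Suc l..k. ennreal (D + \<mu> ^ j * (c / (\<mu> * \<epsilon>))))"
    by (intro add_mono sum_mono early late)
  also have "\<dots> = ennreal (real l * (tail ((1 - c') * u) + real l * \<delta>) +
      (real (k - l) * D + (\<Sum>j=Suc l..k. \<mu> ^ j) * (c / (\<mu> * \<epsilon>))))"
  proof -
    define \<kappa> where "\<kappa> = c / (\<mu> * \<epsilon>)"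
    have "\<kappa> \<ge> 0" using assms mean_pos by (simp add: \<kappa>_def)
    then show ?thesis
      unfolding \<kappa>_def[symmetric] using assms D mean_pos
      by (subst (1 2) sum_ennreal) (auto simp: tail_nonneg sum.distrib sum_distrib_right sum_nonneg simp flip: ennreal_plus)
  qed
  also have "\<dots> \<le> ennreal (real l * (tail ((1 - c') * u) + real l * \<delta>) + real k * D
      + c / (\<mu> * \<epsilon>) * \<mu> ^ l / (1 - \<mu>))"
  proof (intro ennreal_leI)
    have "real (k - l) * D \<le> real k * D" using D by (intro mult_right_mono) auto
    moreover have "(\<Sum>j=Suc l..k. \<mu> ^ j) * (c / (\<mu> * \<epsilon>)) \<le> \<mu> ^ l / (1 - \<mu>) * (c / (\<mu> * \<epsilon>))"
      using assms mean_pos by (intro mult_right_mono sum_mean_powers_le) auto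
    ultimately show "real l * (tail ((1 - c') * u) + real l * \<delta>) +
      (real (k - l) * D + (\<Sum>j=Suc l..k. \<mu> ^ j) * (c / (\<mu> * \<epsilon>))) \<le> real l * (tail ((1 - c') * u) + real l * \<delta>) + real k * D
      + c / (\<mu> * \<epsilon>) * \<mu> ^ l / (1 - \<mu>)"
      by (simp add: mult.commute)
  qed
  finally show ?thesis by (simp add: D_def add_left_mono)
qed

lemma eventually_no_exceedance_le_stay:
  assumes "0 < c" "c < 1" "0 < \<epsilon>" "\<epsilon> < 1" "\<delta> > 0"
  shows "\<forall>\<^sub>F u in at_top. \<forall>k z. \<mu> * real z \<le> c * u \<longrightarrow>
    ennreal (no_exceedance u k) \<le> stay u k z + ennreal (\<delta> + real k * (tail ((1 - \<epsilon>) * u) - tail u))"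
proof -
  define c' where "c' = (c + 1) / 2"
  have c': "c < c'" "c' < 1" using assms by (auto simp: c'_def)
  obtain l where l: "c / (\<mu> * \<epsilon>) * \<mu> ^ l / (1 - \<mu>) < \<delta> / 3"
  proof -
    have "(\<lambda>l. c / (\<mu> * \<epsilon>) * \<mu> ^ l / (1 - \<mu>)) \<longlonglongrightarrow> c / (\<mu> * \<epsilon>) * 0 / (1 - \<mu>)"
      using mean_pos mean_less_1 assms by (intro tendsto_intros LIMSEQ_realpow_zero) auto
    then have "\<forall>\<^sub>F l in sequentially. c / (\<mu> * \<epsilon>) * \<mu> ^ l / (1 - \<mu>) < \<delta> / 3"
      using assms by (intro order_tendstoD(2)) auto
    then show ?thesis using that by (auto simp: eventually_sequentially)
  qed
  \<comment> \<open>Each of the first \<open>l\<close> times costs at most \<open>l \<delta>'\<close>, in total at most \<open>\<delta> / 3\<close>.\<close>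
  define \<delta>' where "\<delta>' = \<delta> / (3 * (real l + 1)\<^sup>2)"
  have \<delta>': "\<delta>' > 0" using assms by (simp add: \<delta>'_def)
  have l2: "real l * (real l * \<delta>') \<le> \<delta> / 3"
  proof -
    have "real l * (real l * \<delta>') \<le> (real l + 1)\<^sup>2 * \<delta>'"
      using \<delta>' by (auto simp: power2_eq_square algebra_simps)
    also have "\<dots> = \<delta> / 3" by (simp add: \<delta>'_def field_simps)
    finally show ?thesis .
  qed
  have "filterlim (\<lambda>u. (1 - c') * u) at_top at_top"
    using c' by real_asymp
  from tendsto_mult_left[OF filterlim_compose[OF tail_tendsto_0 this], of "real l"]
  have "\<forall>\<^sub>F u in at_top. real l * tail ((1 - c') * u) < \<delta> / 3"
    using assms by (intro order_tendstoD(2)) auto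
  then show ?thesis
    using eventually_iterate_gw_not_large[OF assms(1) c'(1) \<delta>'] eventually_gt_at_top[of 0]
  proof eventually_elim
    case (elim u)
    show ?case
    proof (intro allI impI)
      fix k z assume z: "\<mu> * real z \<le> c * u"
      have "ennreal (no_exceedance u k) \<le> stay u k z +
        ennreal (real l * (tail ((1 - c') * u) + real l * \<delta>') + real k * (tail ((1 - \<epsilon>) * u) - tail u)
          + c / (\<mu> * \<epsilon>) * \<mu> ^ l / (1 - \<mu>))"
        using assms c' \<delta>' elim z by (intro no_exceedance_le_stay_bound) auto
      also have "\<dots> \<le> stay u k z + ennreal (\<delta> + real k * (tail ((1 - \<epsilon>) * u) - tail u))"
      proof (intro add_left_mono ennreal_leI)
        have "real l * (tail ((1 - c') * u) + real l * \<delta>') = real l * tail ((1 - c') * u) + real l * (real l * \<delta>')"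
          by (simp add: algebra_simps)
        then show "real l * (tail ((1 - c') * u) + real l * \<delta>') + real k * (tail ((1 - \<epsilon>) * u) - tail u)
          + c / (\<mu> * \<epsilon>) * \<mu> ^ l / (1 - \<mu>) \<le> \<delta> + real k * (tail ((1 - \<epsilon>) * u) - tail u)"
          using elim(1) l l2 by linarith
      qed
      finally show "ennreal (no_exceedance u k) \<le> stay u k z + ennreal (\<delta> + real k * (tail ((1 - \<epsilon>) * u) - tail u))" .
    qed
  qed
qed

lemma no_exceedance_Suc_le:
  "no_exceedance u k - tail u \<le> no_exceedance u (Suc k)"
proof -
  have "(\<integral>\<^sup>+x. (if u < real x then stay u k x else 0) \<partial>\<pi>) \<le> (\<integral>\<^sup>+x. indicator {x. u < real x} x \<partial>\<pi>)"
    by (intro nn_integral_mono) (auto simp: stay_below_le_1)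
  also have "\<dots> = ennreal (tail u)" by (simp add: ennreal_tail)
  finally have "ennreal (no_exceedance u k) \<le> ennreal (no_exceedance u (Suc k)) + ennreal (tail u)"
    unfolding no_exceedance_Suc[of u k] by (rule add_left_mono)
  then show ?thesis
    using no_exceedance_nonneg tail_nonneg by (simp flip: ennreal_plus)
qed

text \<open>Staying below \<open>u\<close> for \<open>k + 1\<close> steps requires that the first offspring sum is below \<open>u\<close>, and
  whatever state is then reached dominates \<open>0\<close>.\<close>

lemma stay_Suc_le: "stay u (Suc k) x \<le> stay u k 0 * emeasure (gw x) {y. real y \<le> u}"
proof -
  have "stay u (Suc k) x = (\<integral>\<^sup>+a. \<integral>\<^sup>+b. (if real (a + b) \<le> u then stay u k (a + b) else 0) \<partial>pB \<partial>gw x)"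
    by (simp add: step_def nn_integral_conv_pmf)
  also have "\<dots> \<le> (\<integral>\<^sup>+a. \<integral>\<^sup>+b. stay u k 0 * indicator {y. real y \<le> u} a \<partial>pB \<partial>gw x)"
  proof (intro nn_integral_mono)
    fix a b
    show "(if real (a + b) \<le> u then stay u k (a + b) else 0) \<le> stay u k 0 * indicator {y. real y \<le> u} a"
      using stay_antimono[of u k 0 "a + b"] by (auto simp: indicator_def)
  qed
  also have "\<dots> = stay u k 0 * emeasure (gw x) {y. real y \<le> u}"
    by (simp add: nn_integral_cmult measure_pmf.emeasure_space_1)
  finally show ?thesis .
qed

text \<open>An exceedance above \<open>(1 + \<epsilon>) u / \<mu>\<close> is followed by another one, up to probability \<open>\<delta>\<close>. The
  first decrement is \<open>tail u\<close>, because no later time is observed, and does not obey the bound.\<close>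

lemma eventually_no_exceedance_decrement_le:
  assumes "\<epsilon> > 0" "\<delta> > 0"
  shows "\<forall>\<^sub>F u in at_top. \<forall>k. no_exceedance u (Suc k) - no_exceedance u (Suc (Suc k)) \<le>
    (tail u - tail ((1 + \<epsilon>) * u / \<mu>) + \<delta> * tail u) * (no_exceedance u (Suc k) + \<delta>)"
proof -
  have "\<forall>\<^sub>F u in at_top. tail u < \<delta> / 2"
    using assms by (intro order_tendstoD(2)[OF tail_tendsto_0]) auto
  moreover have "\<forall>\<^sub>F u in at_top. \<forall>k. stay u k 0 \<le> ennreal (no_exceedance u k + \<delta> / 2)"
    using assms by (intro eventually_stay_0_le) auto
  ultimately show ?thesis
    using eventually_gw_not_small[OF assms] eventually_gt_at_top[of 0]
  proof eventually_elim
    case (elim u)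
    let ?v = "(1 + \<epsilon>) * u / \<mu>"
    have uv: "u \<le> ?v"
    proof -
      have "u * \<mu> \<le> u * 1" using elim(4) mean_less_1 by (intro mult_left_mono) auto
      also have "\<dots> \<le> (1 + \<epsilon>) * u" using elim(4) assms by (simp add: algebra_simps)
      finally show ?thesis using mean_pos by (simp add: field_simps)
    qed
    define Q where "Q = tail u - tail ?v + \<delta> * tail u"
    have t: "tail u - tail ?v \<ge> 0" "Q \<ge> 0"
      using tail_antimono[OF uv] assms tail_nonneg[of u] by (simp_all add: Q_def)
    show ?case
    proof
      fix k
      have p: "no_exceedance u k + \<delta> / 2 \<le> no_exceedance u (Suc k) + \<delta>"
        using no_exceedance_Suc_le[of u k] elim(1) by linarith
      have "(\<integral>\<^sup>+x. (if u < real x then stay u (Suc k) x else 0) \<partial>\<pi>) \<le>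
          (\<integral>\<^sup>+x. ennreal (no_exceedance u (Suc k) + \<delta>) *
            (indicator {x. u < real x \<and> real x \<le> ?v} x + ennreal \<delta> * indicator {x. u < real x} x) \<partial>\<pi>)"
      proof (intro nn_integral_mono)
        fix x
        have "stay u k 0 \<le> ennreal (no_exceedance u (Suc k) + \<delta>)"
          using elim(2) p by (meson ennreal_leI order_trans)
        then have "stay u (Suc k) x \<le> ennreal (no_exceedance u (Suc k) + \<delta>) * emeasure (gw x) {y. real y \<le> u}"
          using stay_Suc_le[of u k x] by (meson mult_right_mono order_trans zero_le)
        also have "\<dots> \<le> ennreal (no_exceedance u (Suc k) + \<delta>) * (indicator {x. real x \<le> ?v} x + ennreal \<delta>)"
        proof (rule mult_left_mono)
          show "emeasure (gw x) {y. real y \<le> u} \<le> indicator {x. real x \<le> ?v} x + ennreal \<delta>"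
            using elim(3) measure_pmf.emeasure_le_1[of "gw x" "{y. real y \<le> u}"]
            by (cases "real x \<le> ?v") (auto intro: add_increasing2)
        qed simp
        finally show "(if u < real x then stay u (Suc k) x else 0) \<le> ennreal (no_exceedance u (Suc k) + \<delta>) *
            (indicator {x. u < real x \<and> real x \<le> ?v} x + ennreal \<delta> * indicator {x. u < real x} x)"
          by (auto simp: indicator_def)
      qed
      also have "\<dots> = ennreal (no_exceedance u (Suc k) + \<delta>) *
         (emeasure \<pi> {x. u < real x \<and> real x \<le> ?v} + ennreal \<delta> * emeasure \<pi> {x. u < real x})"
        by (simp add: nn_integral_cmult nn_integral_add)
      also have "\<dots> = ennreal (no_exceedance u (Suc k) + \<delta>) * ennreal Q"
        using t assms tail_nonneg[of u]
        by (simp add: prob_interval[OF uv] ennreal_tail[symmetric] Q_def ennreal_mult[symmetric] flip: ennreal_plus)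
      also have "\<dots> = ennreal (Q * (no_exceedance u (Suc k) + \<delta>))"
        using t no_exceedance_nonneg[of u "Suc k"] assms by (subst ennreal_mult[symmetric]) (auto simp: mult.commute)
      finally have "ennreal (no_exceedance u (Suc k)) \<le>
          ennreal (no_exceedance u (Suc (Suc k))) + ennreal (Q * (no_exceedance u (Suc k) + \<delta>))"
        unfolding no_exceedance_Suc[of u "Suc k"] by (rule add_left_mono)
      then have "no_exceedance u (Suc k) \<le> no_exceedance u (Suc (Suc k)) + Q * (no_exceedance u (Suc k) + \<delta>)"
        using t assms no_exceedance_nonneg[of u "Suc k"] no_exceedance_nonneg[of u "Suc (Suc k)"]
        by (simp add: add_nonneg_nonneg ennreal_le_iff flip: ennreal_plus)
      then show "no_exceedance u (Suc k) - no_exceedance u (Suc (Suc k)) \<le>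
        (tail u - tail ?v + \<delta> * tail u) * (no_exceedance u (Suc k) + \<delta>)"
        by (simp add: Q_def)
    qed
  qed
qed

text \<open>Only starting states in \<open>(u, c u / \<mu>]\<close> are counted: the chain leaves them to stay below \<open>u\<close> with
  at least almost the stationary probability.\<close>

lemma eventually_no_exceedance_decrement_ge:
  assumes "\<mu> < c" "c < 1" "0 < \<epsilon>" "\<epsilon> < 1" "\<delta> > 0"
  shows "\<forall>\<^sub>F u in at_top. \<forall>k. (tail u - tail (c * u / \<mu>)) *
      (no_exceedance u k - (\<delta> + real k * (tail ((1 - \<epsilon>) * u) - tail u)))
    \<le> no_exceedance u k - no_exceedance u (Suc k)"
proof -
  have c: "0 < c" using assms mean_pos by simp
  show ?thesis
    using eventually_no_exceedance_le_stay[OF c assms(2-5)] eventually_gt_at_top[of 0]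
  proof eventually_elim
    case (elim u)
    let ?v = "c * u / \<mu>"
    have uv: "u \<le> ?v"
      using mult_right_mono[of \<mu> c u] elim(2) assms mean_pos by (simp add: field_simps)
    define Q where "Q = tail u - tail ?v"
    have Q: "Q \<ge> 0" using tail_antimono[OF uv] by (simp add: Q_def)
    show ?case
    proof
      fix k
      define e where "e = \<delta> + real k * (tail ((1 - \<epsilon>) * u) - tail u)"
      have e: "e \<ge> 0"
        using assms elim(2) unfolding e_def by (intro add_nonneg_nonneg mult_nonneg_nonneg) (auto intro!: tail_antimono simp: mult_left_le_one_le)
      let ?I = "{x. u < real x \<and> real x \<le> ?v}"
      have "ennreal (no_exceedance u k) * ennreal Q = (\<integral>\<^sup>+x. ennreal (no_exceedance u k) * indicator ?I x \<partial>\<pi>)"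
        by (simp add: nn_integral_cmult prob_interval[OF uv] Q_def)
      also have "\<dots> \<le> (\<integral>\<^sup>+x. (if u < real x then stay u k x else 0) + ennreal e * indicator ?I x \<partial>\<pi>)"
      proof (intro nn_integral_mono)
        fix x
        show "ennreal (no_exceedance u k) * indicator ?I x \<le> (if u < real x then stay u k x else 0) + ennreal e * indicator ?I x"
          using elim(1) mean_pos by (auto simp: indicator_def e_def field_simps)
      qed
      also have "\<dots> = (\<integral>\<^sup>+x. (if u < real x then stay u k x else 0) \<partial>\<pi>) + ennreal e * ennreal Q"
        by (simp add: nn_integral_add nn_integral_cmult prob_interval[OF uv] Q_def)
      finally have "ennreal (no_exceedance u (Suc k)) + ennreal (no_exceedance u k) * ennreal Q \<le>
          ennreal (no_exceedance u k) + ennreal e * ennreal Q"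
        unfolding no_exceedance_Suc[of u k] by (simp add: add_left_mono add.assoc)
      then have "ennreal (no_exceedance u (Suc k) + no_exceedance u k * Q) \<le> ennreal (no_exceedance u k + e * Q)"
        using Q e no_exceedance_nonneg by (simp add: ennreal_mult)
      then have "no_exceedance u (Suc k) + no_exceedance u k * Q \<le> no_exceedance u k + e * Q"
        using Q e no_exceedance_nonneg by (subst (asm) ennreal_le_iff) auto
      then show "(tail u - tail (c * u / \<mu>)) *
          (no_exceedance u k - (\<delta> + real k * (tail ((1 - \<epsilon>) * u) - tail u)))
          \<le> no_exceedance u k - no_exceedance u (Suc k)"
        by (simp add: Q_def e_def algebra_simps)
    qed
  qed
qed

end

section \<open>From decrement bounds to the exponential limit\<close>

text \<open>Squeezing with bounds that become sharp only as an auxiliary parameter tends to \<open>0\<close>.\<close>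

lemma tendsto_squeeze_parameter:
  fixes f :: "nat \<Rightarrow> real" and lo hi :: "real \<Rightarrow> real"
  assumes lo: "(lo \<longlongrightarrow> l) (at_right 0)" and hi: "(hi \<longlongrightarrow> l) (at_right 0)"
    and lower: "\<forall>\<^sub>F \<epsilon> in at_right 0. \<exists>g. g \<longlonglongrightarrow> lo \<epsilon> \<and> (\<forall>\<^sub>F n in sequentially. g n \<le> f n)"
    and upper: "\<forall>\<^sub>F \<epsilon> in at_right 0. \<exists>g. g \<longlonglongrightarrow> hi \<epsilon> \<and> (\<forall>\<^sub>F n in sequentially. f n \<le> g n)"
  shows "f \<longlonglongrightarrow> l"
proof (rule order_tendstoI)
  fix y assume "y < l"
  have "\<exists>\<epsilon>. y < lo \<epsilon> \<and> (\<exists>g. g \<longlonglongrightarrow> lo \<epsilon> \<and> (\<forall>\<^sub>F n in sequentially. g n \<le> f n))"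
    by (rule eventually_happens[OF eventually_conj[OF order_tendstoD(1)[OF lo \<open>y < l\<close>] lower], simplified])
  then obtain \<epsilon> g where g: "y < lo \<epsilon>" "g \<longlonglongrightarrow> lo \<epsilon>" "\<forall>\<^sub>F n in sequentially. g n \<le> f n"
    by blast
  show "\<forall>\<^sub>F n in sequentially. y < f n"
    using order_tendstoD(1)[OF g(2,1)] g(3) by eventually_elim simp
next
  fix y assume "l < y"
  have "\<exists>\<epsilon>. hi \<epsilon> < y \<and> (\<exists>g. g \<longlonglongrightarrow> hi \<epsilon> \<and> (\<forall>\<^sub>F n in sequentially. f n \<le> g n))"
    by (rule eventually_happens[OF eventually_conj[OF order_tendstoD(2)[OF hi \<open>l < y\<close>] upper], simplified])
  then obtain \<epsilon> g where g: "hi \<epsilon> < y" "g \<longlonglongrightarrow> hi \<epsilon>" "\<forall>\<^sub>F n in sequentially. f n \<le> g n"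
    by blast
  show "\<forall>\<^sub>F n in sequentially. f n < y"
    using order_tendstoD(2)[OF g(2,1)] g(3) by eventually_elim simp
qed

lemma power_ge_exp:
  fixes q :: real
  assumes "0 \<le> q" "q < 1"
  shows "exp (- (real n * q / (1 - q))) \<le> (1 - q) ^ n"
proof -
  have "1 / (1 - q) \<le> exp (q / (1 - q))"
    using exp_ge_add_one_self[of "q / (1 - q)"] assms by (simp add: field_simps)
  then have "exp (- (q / (1 - q))) \<le> 1 - q"
    using assms by (simp add: exp_minus field_simps)
  then have "exp (- (q / (1 - q))) ^ n \<le> (1 - q) ^ n"
    by (intro power_mono) auto
  then show ?thesis by (simp flip: exp_of_nat_mult)
qed

lemma power_le_exp:
  fixes q :: real
  assumes "q \<le> 1"
  shows "(1 - q) ^ n \<le> exp (- (real n * q))"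
proof -
  have "(1 - q) ^ n \<le> exp (- q) ^ n"
    using exp_ge_add_one_self[of "- q"] assms by (intro power_mono) auto
  then show ?thesis by (simp flip: exp_of_nat_mult)
qed

lemma affine_recursion_lower_bound:
  fixes p :: "nat \<Rightarrow> real"
  assumes "0 \<le> q" "q \<le> 1" "0 \<le> \<delta>" and "1 - \<delta> \<le> p 1"
    and "\<And>k. p (Suc k) - p (Suc (Suc k)) \<le> q * (p (Suc k) + \<delta>)"
  shows "(1 - q) ^ k - \<delta> - real k * q * \<delta> \<le> p (Suc k)"
proof (induction k)
  case 0
  show ?case using assms by simp
next
  case (Suc k)
  have "(1 - q) * ((1 - q) ^ k - \<delta> - real k * q * \<delta>) \<le> (1 - q) * p (Suc k)"
    using Suc.IH assms by (intro mult_left_mono) auto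
  moreover have "(1 - q) * p (Suc k) - q * \<delta> \<le> p (Suc (Suc k))"
    using assms(5)[of k] by (simp add: algebra_simps)
  moreover have "0 \<le> q * \<delta> + real k * (q * (q * \<delta>))" using assms by simp
  ultimately show ?case by (simp add: algebra_simps)
qed

lemma affine_recursion_upper_bound:
  fixes p :: "nat \<Rightarrow> real"
  assumes "0 \<le> q" "q \<le> 1" "0 \<le> \<delta>" "0 \<le> d" and "p 0 = 1"
    and "\<And>k. q * (p k - (\<delta> + real k * d)) \<le> p k - p (Suc k)"
    and "k \<le> n"
  shows "p k \<le> (1 - q) ^ k + real k * q * (\<delta> + real n * d)"
  using \<open>k \<le> n\<close>
proof (induction k)
  case 0
  show ?case using assms by simp
next
  case (Suc k)
  define e where "e = \<delta> + real n * d"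
  have e: "0 \<le> e" using assms by (simp add: e_def)
  have "p (Suc k) \<le> (1 - q) * p k + q * (\<delta> + real k * d)"
    using assms(6)[of k] by (simp add: algebra_simps)
  also have "\<dots> \<le> (1 - q) * ((1 - q) ^ k + real k * q * e) + q * e"
    using Suc assms unfolding e_def by (intro add_mono mult_left_mono mult_right_mono) auto
  also have "\<dots> \<le> (1 - q) ^ Suc k + real (Suc k) * q * e"
  proof -
    have "0 \<le> q * (real k * q * e)" using assms e by simp
    then show ?thesis by (simp add: algebra_simps)
  qed
  finally show ?case by (simp add: e_def)
qed

context stationary_branching_kernel
begin

text \<open>If \<open>a n\<close> returned below some \<open>R\<close> infinitely often, \<open>n tail (a n)\<close> could stay bounded only if
  \<open>tail R = 0\<close>. But a stationary law with bounded support cannot satisfy the limit relation: the variable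
  being integer-valued, it would have to be \<open>0\<close>, and then \<open>a n < 0\<close> and \<open>tail (a n) = 1\<close>.\<close>

lemma norming_sequence_at_top:
  assumes lim: "\<And>u. u > 0 \<Longrightarrow> (\<lambda>n. real n * tail (a n * u)) \<longlonglongrightarrow> u powr (- \<alpha>)"
  shows "filterlim a at_top sequentially"
proof -
  have pos: "\<forall>\<^sub>F n in sequentially. 0 < tail (a n * u)" if "u > 0" for u
  proof -
    have "0 < u powr (- \<alpha>)" using that by simp
    from order_tendstoD(1)[OF lim[OF that] this] show ?thesis by eventually_elim (simp add: zero_less_mult_iff)
  qed
  have bound: "\<forall>\<^sub>F n in sequentially. real n * tail (a n) < 2"
    using lim[of 1] by (intro order_tendstoD(2)) auto
  have large: "\<forall>\<^sub>F n in sequentially. tail (a n) < t" if "t > 0" for t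
    using bound eventually_gt_at_top[of "nat \<lceil>2 / t\<rceil>"]
  proof eventually_elim
    case (elim n)
    have "2 / t < real n" using elim(2) by linarith
    then have "2 < real n * t" using that by (simp add: field_simps)
    with elim(1) have "real n * tail (a n) < real n * t" by simp
    then show ?case by (simp add: mult_less_cancel_left)
  qed
  have tail_pos: "tail R > 0" if "R \<ge> 0" for R
  proof (rule ccontr)
    assume "\<not> tail R > 0"
    then have R: "tail R = 0" using tail_nonneg[of R] by simp
    \<comment> \<open>Dividing by \<open>R + 1\<close> pushes \<open>a n\<close> below 1, where the tail of an integer variable is at least \<open>tail 0\<close>.\<close>
    have "R + 1 > 0" using that by simp
    from pos[OF this] have "\<forall>\<^sub>F n in sequentially. a n < 1"
    proof eventually_elim
      case (elim n)
      show ?case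
      proof (rule ccontr)
        assume "\<not> a n < 1"
        then have "1 * (R + 1) \<le> a n * (R + 1)" using that by (intro mult_right_mono) auto
        then have "tail (a n * (R + 1)) \<le> tail R" by (intro tail_antimono) simp
        with elim R show False by simp
      qed
    qed
    have tail0: "\<not> tail 0 > 0"
    proof
      assume "tail 0 > 0"
      from large[OF this] \<open>\<forall>\<^sub>F n in sequentially. a n < 1\<close>
      have "\<forall>\<^sub>F n in sequentially. False"
      proof eventually_elim
        case (elim n)
        have "tail 0 \<le> tail (a n)"
          unfolding tail_def using elim by (intro measure_pmf.finite_measure_mono) auto
        with elim show False by simp
      qed
      then show False by simp
    qed
    have "\<forall>\<^sub>F n in sequentially. False"
      using pos[OF zero_less_one] large[OF zero_less_one]
    proof eventually_elim
      case (elim n)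
      have "a n < 0"
        using elim(1) tail0 tail_antimono[of 0 "a n"] by fastforce
      then have "{x. a n < real x} = UNIV" by auto
      with elim(2) show False by (simp add: tail_def)
    qed
    then show False by simp
  qed
  show ?thesis
    unfolding filterlim_at_top_gt[where c = 0]
  proof (intro allI impI)
    fix R :: real assume "0 < R"
    then have "tail R > 0" by (intro tail_pos) simp
    from large[OF this] show "\<forall>\<^sub>F n in sequentially. R \<le> a n"
    proof eventually_elim
      case (elim n)
      show ?case by (rule ccontr) (use elim tail_antimono[of "a n" R] in simp)
    qed
  qed
qed

text \<open>For every small \<open>\<epsilon>\<close> the decrement bounds sandwich the probability between sequences that
  converge to \<open>exp (- qlo \<epsilon>)\<close> and \<open>exp (- qhi \<epsilon>)\<close>, up to terms vanishing with \<open>\<epsilon>\<close>; both rates tend to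
  \<open>(1 - \<mu>\<^sup>\<alpha>) x\<^sup>-\<^sup>\<alpha>\<close>.\<close>

lemma no_exceedance_tendsto:
  assumes lim: "\<And>u. u > 0 \<Longrightarrow> (\<lambda>n. real n * tail (a n * u)) \<longlonglongrightarrow> u powr (- \<alpha>)"
    and x: "x > 0"
  shows "(\<lambda>n. no_exceedance (a n * x) n) \<longlonglongrightarrow> exp (- (1 - \<mu> powr \<alpha>) * x powr (- \<alpha>))"
proof -
  define L where "L = x powr (- \<alpha>)"
  have L: "L > 0" using x by (simp add: L_def)
  let ?u = "\<lambda>n. a n * x"
  have u_lim: "filterlim ?u at_top sequentially"
    using norming_sequence_at_top[OF lim] x by (intro filterlim_at_top_mult_tendsto_pos tendsto_const) auto
  have scaled: "(\<lambda>n. real n * tail (r * ?u n)) \<longlonglongrightarrow> r powr (- \<alpha>) * L" if "r > 0" for r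
    using lim[of "x * r"] that x by (simp add: L_def powr_mult mult_ac)
  have unscaled: "(\<lambda>n. real n * tail (?u n)) \<longlonglongrightarrow> L"
    using scaled[of 1] by simp
  define qlo where "qlo \<epsilon> = L - ((1 + \<epsilon>) / \<mu>) powr (- \<alpha>) * L + \<epsilon> * L" for \<epsilon>
  define qhi where "qhi \<epsilon> = L - ((1 - \<epsilon>) / \<mu>) powr (- \<alpha>) * L" for \<epsilon>
  define dhi where "dhi \<epsilon> = (1 - \<epsilon>) powr (- \<alpha>) * L - L" for \<epsilon>
  have rate: "L - (1 / \<mu>) powr (- \<alpha>) * L = (1 - \<mu> powr \<alpha>) * x powr (- \<alpha>)"
    using mean_pos by (simp add: L_def powr_divide powr_minus_divide left_diff_distrib diff_divide_distrib)
  have qlo_lim: "(qlo \<longlongrightarrow> L - (1 / \<mu>) powr (- \<alpha>) * L) (at_right 0)"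
  proof -
    have "((\<lambda>\<epsilon>. L - ((1 + \<epsilon>) / \<mu>) powr (- \<alpha>) * L + \<epsilon> * L) \<longlongrightarrow> L - ((1 + 0) / \<mu>) powr (- \<alpha>) * L + 0 * L) (at_right 0)"
      using mean_pos by (intro tendsto_intros) auto
    then show ?thesis by (simp add: qlo_def[abs_def])
  qed
  have qhi_lim: "(qhi \<longlongrightarrow> L - (1 / \<mu>) powr (- \<alpha>) * L) (at_right 0)"
  proof -
    have "((\<lambda>\<epsilon>. L - ((1 - \<epsilon>) / \<mu>) powr (- \<alpha>) * L) \<longlongrightarrow> L - ((1 - 0) / \<mu>) powr (- \<alpha>) * L) (at_right 0)"
      using mean_pos by (intro tendsto_intros) auto
    then show ?thesis by (simp add: qhi_def[abs_def])
  qed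
  have dhi_lim: "(dhi \<longlongrightarrow> 0) (at_right 0)"
  proof -
    have "((\<lambda>\<epsilon>. (1 - \<epsilon>) powr (- \<alpha>) * L - L) \<longlongrightarrow> (1 - 0) powr (- \<alpha>) * L - L) (at_right 0)"
      by (intro tendsto_intros) auto
    then show ?thesis by (simp add: dhi_def[abs_def])
  qed
  have small: "\<forall>\<^sub>F \<epsilon> in at_right 0. 0 < \<epsilon> \<and> \<epsilon> < 1 - \<mu>"
    using mean_less_1 by (auto simp: eventually_at_right_field intro!: exI[of _ "1 - \<mu>"])
  have "(\<lambda>n. no_exceedance (a n * x) n) \<longlonglongrightarrow> exp (- (L - (1 / \<mu>) powr (- \<alpha>) * L))"
  proof (rule tendsto_squeeze_parameter[where
        lo = "\<lambda>\<epsilon>. exp (- (qlo \<epsilon> / (1 - 0))) - \<epsilon> - qlo \<epsilon> * \<epsilon>" and hi = "\<lambda>\<epsilon>. exp (- qhi \<epsilon>) + qhi \<epsilon> * (\<epsilon> + dhi \<epsilon>)"])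
    have "((\<lambda>\<epsilon>. exp (- (qlo \<epsilon> / (1 - 0))) - \<epsilon> - qlo \<epsilon> * \<epsilon>) \<longlongrightarrow>
        exp (- ((L - (1 / \<mu>) powr (- \<alpha>) * L) / (1 - 0))) - 0 - (L - (1 / \<mu>) powr (- \<alpha>) * L) * 0) (at_right 0)"
      by (intro tendsto_intros qlo_lim) simp
    then show "((\<lambda>\<epsilon>. exp (- (qlo \<epsilon> / (1 - 0))) - \<epsilon> - qlo \<epsilon> * \<epsilon>) \<longlongrightarrow> exp (- (L - (1 / \<mu>) powr (- \<alpha>) * L))) (at_right 0)"
      by simp
    have "((\<lambda>\<epsilon>. exp (- qhi \<epsilon>) + qhi \<epsilon> * (\<epsilon> + dhi \<epsilon>)) \<longlongrightarrow>
        exp (- (L - (1 / \<mu>) powr (- \<alpha>) * L)) + (L - (1 / \<mu>) powr (- \<alpha>) * L) * (0 + 0)) (at_right 0)"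
      by (intro tendsto_intros qhi_lim dhi_lim)
    then show "((\<lambda>\<epsilon>. exp (- qhi \<epsilon>) + qhi \<epsilon> * (\<epsilon> + dhi \<epsilon>)) \<longlongrightarrow> exp (- (L - (1 / \<mu>) powr (- \<alpha>) * L))) (at_right 0)"
      by simp
  next
    show "\<forall>\<^sub>F \<epsilon> in at_right 0. \<exists>g. g \<longlonglongrightarrow> exp (- (qlo \<epsilon> / (1 - 0))) - \<epsilon> - qlo \<epsilon> * \<epsilon> \<and>
        (\<forall>\<^sub>F n in sequentially. g n \<le> no_exceedance (?u n) n)"
      using small
    proof eventually_elim
      case (elim \<epsilon>)
      then have e: "0 < \<epsilon>" by simp
      define Q where "Q n = tail (?u n) - tail ((1 + \<epsilon>) * ?u n / \<mu>) + \<epsilon> * tail (?u n)" for n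
      have nQ: "(\<lambda>n. real n * Q n) \<longlonglongrightarrow> qlo \<epsilon>"
      proof -
        have "(\<lambda>n. real n * tail (?u n) - real n * tail ((1 + \<epsilon>) / \<mu> * ?u n) + \<epsilon> * (real n * tail (?u n))) \<longlonglongrightarrow> qlo \<epsilon>"
          unfolding qlo_def using e mean_pos by (intro tendsto_intros scaled unscaled) auto
        then show ?thesis by (simp add: Q_def algebra_simps)
      qed
      have Q0: "Q \<longlonglongrightarrow> 0"
      proof -
        have "(\<lambda>n. real n * Q n * (1 / real n)) \<longlonglongrightarrow> qlo \<epsilon> * 0"
          by (intro tendsto_mult nQ lim_1_over_n)
        moreover have "\<forall>\<^sub>F n in sequentially. real n * Q n * (1 / real n) = Q n"
          using eventually_gt_at_top[of 0] by eventually_elim simp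
        ultimately show ?thesis by (simp add: tendsto_cong)
      qed
      let ?g = "\<lambda>n. exp (- (real n * Q n / (1 - Q n))) - \<epsilon> - real n * Q n * \<epsilon>"
      have "?g \<longlonglongrightarrow> exp (- (qlo \<epsilon> / (1 - 0))) - \<epsilon> - qlo \<epsilon> * \<epsilon>"
        by (intro tendsto_intros nQ Q0) simp
      moreover have "\<forall>\<^sub>F n in sequentially. ?g n \<le> no_exceedance (?u n) n"
        using filterlim_iff[THEN iffD1, OF u_lim, rule_format, OF eventually_no_exceedance_decrement_le[OF e e]]
          order_tendstoD(2)[OF Q0 zero_less_one]
          filterlim_iff[THEN iffD1, OF u_lim, rule_format, OF order_tendstoD(2)[OF tail_tendsto_0 e]]
          filterlim_iff[THEN iffD1, OF u_lim, rule_format, OF eventually_gt_at_top[of 0]]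
          eventually_gt_at_top[of 0]
      proof eventually_elim
        case (elim n)
        obtain m where m: "n = Suc m" using elim(5) by (cases n) auto
        have "?u n \<le> (1 + \<epsilon>) * ?u n / \<mu>"
        proof -
          have "?u n * \<mu> \<le> ?u n * 1" using elim(4) mean_less_1 by (intro mult_left_mono) auto
          also have "\<dots> \<le> (1 + \<epsilon>) * ?u n" using elim(4) e by (simp add: algebra_simps)
          finally show ?thesis using mean_pos by (simp add: field_simps)
        qed
        then have Q: "Q n \<ge> 0"
          using tail_antimono[of "?u n" "(1 + \<epsilon>) * ?u n / \<mu>"] e tail_nonneg[of "?u n"] by (simp add: Q_def)
        have "1 - \<epsilon> \<le> no_exceedance (?u n) 1"
          using no_exceedance_Suc_le[of "?u n" 0] elim(3) by (simp add: no_exceedance_0)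
        then have "(1 - Q n) ^ m - \<epsilon> - real m * Q n * \<epsilon> \<le> no_exceedance (?u n) (Suc m)"
          using elim(1,2) Q e by (intro affine_recursion_lower_bound) (auto simp: Q_def)
        moreover have "(1 - Q n) ^ n \<le> (1 - Q n) ^ m"
          using Q elim(2) by (intro power_decreasing) (auto simp: m)
        moreover have "real m * Q n * \<epsilon> \<le> real n * Q n * \<epsilon>"
          using Q e by (intro mult_right_mono) (auto simp: m)
        moreover have "exp (- (real n * Q n / (1 - Q n))) \<le> (1 - Q n) ^ n"
          by (rule power_ge_exp[OF Q elim(2)])
        ultimately show ?case unfolding m by linarith
      qed
      ultimately show ?case by blast
    qed
  next
    show "\<forall>\<^sub>F \<epsilon> in at_right 0. \<exists>g. g \<longlonglongrightarrow> exp (- qhi \<epsilon>) + qhi \<epsilon> * (\<epsilon> + dhi \<epsilon>) \<and>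
        (\<forall>\<^sub>F n in sequentially. no_exceedance (?u n) n \<le> g n)"
      using small
    proof eventually_elim
      case (elim \<epsilon>)
      then have e: "0 < \<epsilon>" "\<epsilon> < 1" "\<mu> < 1 - \<epsilon>" "1 - \<epsilon> < 1" using mean_pos by auto
      define Q where "Q n = tail (?u n) - tail ((1 - \<epsilon>) * ?u n / \<mu>)" for n
      define D where "D n = tail ((1 - \<epsilon>) * ?u n) - tail (?u n)" for n
      have nQ: "(\<lambda>n. real n * Q n) \<longlonglongrightarrow> qhi \<epsilon>"
      proof -
        have "(\<lambda>n. real n * tail (?u n) - real n * tail ((1 - \<epsilon>) / \<mu> * ?u n)) \<longlonglongrightarrow> qhi \<epsilon>"
          unfolding qhi_def using e mean_pos by (intro tendsto_intros scaled unscaled) auto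
        then show ?thesis by (simp add: Q_def algebra_simps)
      qed
      have nD: "(\<lambda>n. real n * D n) \<longlonglongrightarrow> dhi \<epsilon>"
      proof -
        have "(\<lambda>n. real n * tail ((1 - \<epsilon>) * ?u n) - real n * tail (?u n)) \<longlonglongrightarrow> dhi \<epsilon>"
          unfolding dhi_def using e by (intro tendsto_intros scaled unscaled) auto
        then show ?thesis by (simp add: D_def algebra_simps)
      qed
      let ?g = "\<lambda>n. exp (- (real n * Q n)) + real n * Q n * (\<epsilon> + real n * D n)"
      have "?g \<longlonglongrightarrow> exp (- qhi \<epsilon>) + qhi \<epsilon> * (\<epsilon> + dhi \<epsilon>)"
        by (intro tendsto_intros nQ nD)
      moreover have "\<forall>\<^sub>F n in sequentially. no_exceedance (?u n) n \<le> ?g n"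
        using filterlim_iff[THEN iffD1, OF u_lim, rule_format, OF eventually_no_exceedance_decrement_ge[OF e(3,4,1,2,1)]]
          filterlim_iff[THEN iffD1, OF u_lim, rule_format, OF eventually_gt_at_top[of 0]]
      proof eventually_elim
        case (elim n)
        have "?u n \<le> (1 - \<epsilon>) * ?u n / \<mu>"
          using mult_right_mono[of \<mu> "1 - \<epsilon>" "?u n"] elim(2) e mean_pos by (simp add: field_simps)
        then have Q: "0 \<le> Q n" "Q n \<le> 1"
          using tail_antimono[of "?u n" "(1 - \<epsilon>) * ?u n / \<mu>"] tail_le_1[of "?u n"] tail_nonneg[of "(1 - \<epsilon>) * ?u n / \<mu>"]
          by (simp_all add: Q_def)
        have D: "0 \<le> D n"
          unfolding D_def using e elim(2) by (auto intro!: tail_antimono mult_left_le_one_le)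
        have "no_exceedance (?u n) n \<le> (1 - Q n) ^ n + real n * Q n * (\<epsilon> + real n * D n)"
          using elim(1) e Q D
          by (intro affine_recursion_upper_bound) (auto simp: no_exceedance_0 Q_def D_def)
        also have "(1 - Q n) ^ n \<le> exp (- (real n * Q n))"
          using Q by (intro power_le_exp)
        finally show ?case by simp
      qed
      ultimately show ?case by blast
    qed
  qed
  then show ?thesis unfolding rate by (simp only: minus_mult_left)
qed

end

section \<open>The path law of the process\<close>

lemma (in prob_space) obtain_law_pmf:
  fixes Y :: "'a \<Rightarrow> nat"
  assumes "Y \<in> measurable M (count_space UNIV)"
  shows "\<exists>p. measure_pmf p = distr M (count_space UNIV) Y"
proof -
  interpret D: prob_space "distr M (count_space UNIV) Y"
    by (rule prob_space_distr[OF assms])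
  have "AE x in distr M (count_space UNIV) Y. measure (distr M (count_space UNIV) Y) {x} \<noteq> 0"
    by (subst D.AE_support_countable) auto
  then have "measure_pmf (Abs_pmf (distr M (count_space UNIV) Y)) = distr M (count_space UNIV) Y"
    by (intro Abs_pmf_inverse) (auto intro: D.prob_space_axioms)
  then show ?thesis by blast
qed

lemma pmf_conv_pmf: "pmf (conv_pmf p q) y = (\<Sum>s\<le>y. pmf p s * pmf q (y - s))"
proof -
  have "pmf (conv_pmf p q) y = measure (pair_pmf p q) ((\<lambda>(x, y). x + y) -` {y})"
    by (simp add: conv_pmf_def pmf_map)
  also have "(\<lambda>(x, y). x + y) -` {y} = (\<lambda>s. (s, y - s)) ` {..y}"
    by (auto simp: image_iff)
  also have "measure (pair_pmf p q) \<dots> = (\<Sum>z\<in>(\<lambda>s. (s, y - s)) ` {..y}. pmf (pair_pmf p q) z)"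
    by (intro measure_measure_pmf_finite) auto
  also have "\<dots> = (\<Sum>s\<le>y. pmf (pair_pmf p q) (s, y - s))"
    by (subst sum.reindex) (auto intro: inj_onI)
  finally show ?thesis by (simp add: pmf_pair)
qed

lemma (in prob_space) prob_indep_sum:
  fixes Y Z :: "'a \<Rightarrow> nat"
  assumes indep: "indep_var (count_space UNIV) Y (count_space UNIV) Z"
    and Y: "\<And>y. prob {\<omega> \<in> space M. Y \<omega> = y} = pmf p y"
    and Z: "\<And>y. prob {\<omega> \<in> space M. Z \<omega> = y} = pmf q y"
  shows "prob {\<omega> \<in> space M. Y \<omega> + Z \<omega> = y} = pmf (conv_pmf p q) y"
proof -
  have [measurable]: "Y \<in> measurable M (count_space UNIV)" "Z \<in> measurable M (count_space UNIV)"
    using indep_var_rv1[OF indep] indep_var_rv2[OF indep] by auto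
  have "{\<omega> \<in> space M. Y \<omega> + Z \<omega> = y} = (\<Union>s\<in>{..y}. (Y -` {s} \<inter> space M) \<inter> (Z -` {y - s} \<inter> space M))"
    by auto
  then have "prob {\<omega> \<in> space M. Y \<omega> + Z \<omega> = y} = (\<Sum>s\<le>y. prob ((Y -` {s} \<inter> space M) \<inter> (Z -` {y - s} \<inter> space M)))"
    by (simp, intro finite_measure_finite_Union) (auto simp: disjoint_family_on_def)
  also have "\<dots> = (\<Sum>s\<le>y. pmf p s * pmf q (y - s))"
  proof (intro sum.cong refl)
    fix s
    have "prob ((Y -` {s} \<inter> space M) \<inter> (Z -` {y - s} \<inter> space M)) = prob (Y -` {s} \<inter> space M) * prob (Z -` {y - s} \<inter> space M)"
    proof -
      have "(\<lambda>\<omega>. (Y \<omega>, Z \<omega>)) -` ({s} \<times> {y - s}) \<inter> space M = (Y -` {s} \<inter> space M) \<inter> (Z -` {y - s} \<inter> space M)"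
        by auto
      then show ?thesis using indep_varD[OF indep, of "{s}" "{y - s}"] by simp
    qed
    also have "\<dots> = pmf p s * pmf q (y - s)"
      using Y[of s] Z[of "y - s"] by (simp add: vimage_def Int_def conj_commute)
    finally show "prob ((Y -` {s} \<inter> space M) \<inter> (Z -` {y - s} \<inter> space M)) = pmf p s * pmf q (y - s)" .
  qed
  finally show ?thesis by (simp add: pmf_conv_pmf)
qed

lemma (in prob_space) prob_indep_sum_iid:
  fixes Y :: "nat \<Rightarrow> 'a \<Rightarrow> nat"
  assumes indep: "indep_vars (\<lambda>_. count_space UNIV) Y {1..}"
    and law: "\<And>i y. i \<ge> 1 \<Longrightarrow> prob {\<omega> \<in> space M. Y i \<omega> = y} = pmf p y"
  shows "prob {\<omega> \<in> space M. (\<Sum>i=1..m. Y i \<omega>) = y} = pmf (sum_iid_pmf p m) y"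
proof (induction m arbitrary: y)
  case 0
  show ?case by (auto simp: prob_space pmf_return indicator_def)
next
  case (Suc m)
  have "indep_var (PiM {Suc m} (\<lambda>_. count_space UNIV)) (\<lambda>\<omega>. restrict (\<lambda>i. Y i \<omega>) {Suc m})
      (PiM {1..m} (\<lambda>_. count_space UNIV)) (\<lambda>\<omega>. restrict (\<lambda>i. Y i \<omega>) {1..m})"
    by (rule indep_var_restrict[OF indep]) auto
  then have "indep_var (count_space UNIV) ((\<lambda>f. f (Suc m)) \<circ> (\<lambda>\<omega>. restrict (\<lambda>i. Y i \<omega>) {Suc m}))
      (count_space UNIV) ((\<lambda>f. \<Sum>i=1..m. f i) \<circ> (\<lambda>\<omega>. restrict (\<lambda>i. Y i \<omega>) {1..m}))"
    by (rule indep_var_compose) (auto intro!: measurable_component_singleton)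
  then have "indep_var (count_space UNIV) (Y (Suc m)) (count_space UNIV) (\<lambda>\<omega>. \<Sum>i=1..m. Y i \<omega>)"
    by (simp add: comp_def)
  from prob_indep_sum[OF this law Suc.IH, of y] show ?case
    by (simp add: add.commute)
qed

lemma measurable_add_nat:
  fixes f g :: "'a \<Rightarrow> nat"
  assumes "f \<in> measurable M (count_space UNIV)" and [measurable]: "g \<in> measurable M (count_space UNIV)"
  shows "(\<lambda>\<omega>. f \<omega> + g \<omega>) \<in> measurable M (count_space UNIV)"
  using assms(1) by (rule measurable_compose_countable[rotated]) measurable

lemma measurable_sum_nat:
  fixes f :: "'i \<Rightarrow> 'a \<Rightarrow> nat"
  assumes "\<And>i. i \<in> I \<Longrightarrow> f i \<in> measurable M (count_space UNIV)"
  shows "(\<lambda>\<omega>. \<Sum>i\<in>I. f i \<omega>) \<in> measurable M (count_space UNIV)"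
  using assms by (induction I rule: infinite_finite_induct) (auto intro: measurable_add_nat)

text \<open>The recursion together with the laws and the independence of the noise: this is what determines
  the path law as that of the Markov chain with kernel \<open>step\<close>.\<close>

locale branching_process = prob_space M + branching_kernel pA pB
  for M :: "'a measure" and pA pB :: "nat pmf" +
  fixes As :: "int \<Rightarrow> nat \<Rightarrow> 'a \<Rightarrow> nat" and Bs X :: "int \<Rightarrow> 'a \<Rightarrow> nat"
  assumes offspring_law: "\<And>t i y. i \<ge> 1 \<Longrightarrow> prob {\<omega> \<in> space M. As t i \<omega> = y} = pmf pA y"
    and immigration_law: "\<And>t y. prob {\<omega> \<in> space M. Bs t \<omega> = y} = pmf pB y"
    and indep_noise: "indep_vars (\<lambda>_. count_space UNIV) (noise As Bs) ((UNIV \<times> {1..}) <+> UNIV)"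
    and X_measurable [measurable]: "\<And>t. X t \<in> measurable M (count_space UNIV)"
    and recursion: "\<And>t. AE \<omega> in M. X t \<omega> = (\<Sum>i=1..X (t - 1) \<omega>. As t i \<omega>) + Bs t \<omega>"
    and indep_past: "\<And>t. indep_set
      (sets (vimage_algebra (space M) (X (t - 1)) (count_space UNIV)))
      (sets (vimage_algebra (space M) (\<lambda>\<omega>. \<lambda>k\<in>noise_from t. noise As Bs k \<omega>)
        (\<Pi>\<^sub>M k\<in>noise_from t. count_space UNIV)))"
begin

definition transition :: "int \<Rightarrow> nat \<Rightarrow> 'a \<Rightarrow> nat" where
  "transition t m \<omega> = (\<Sum>i=1..m. As t i \<omega>) + Bs t \<omega>"

text \<open>For deterministic population sizes \<open>m t\<close> the transition at time \<open>t\<close> uses only the noise of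
  time \<open>t\<close>, and the noise blocks of different times are independent.\<close>

lemma indep_transition: "indep_vars (\<lambda>_. count_space UNIV) (\<lambda>t. transition t (m t)) UNIV"
proof -
  let ?K = "\<lambda>t::int. ({t} \<times> {1::nat..}) <+> {t}"
  let ?Y = "\<lambda>t f. (\<Sum>i=1..m t. f (Inl (t, i))) + f (Inr t) :: nat"
  have "indep_vars (\<lambda>t. PiM (?K t) (\<lambda>_. count_space UNIV)) (\<lambda>t \<omega>. restrict (\<lambda>k. noise As Bs k \<omega>) (?K t)) UNIV"
    by (rule indep_vars_restrict[OF indep_noise]) (auto simp: disjoint_family_on_def)
  then have "indep_vars (\<lambda>_. count_space UNIV) (\<lambda>t \<omega>. ?Y t (restrict (\<lambda>k. noise As Bs k \<omega>) (?K t))) UNIV"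
  proof (rule indep_vars_compose2)
    fix t :: int
    have comp: "(\<lambda>f. f k) \<in> measurable (PiM (?K t) (\<lambda>_. count_space UNIV)) (count_space (UNIV :: nat set))" if "k \<in> ?K t" for k
      using that by (rule measurable_component_singleton)
    show "?Y t \<in> measurable (PiM (?K t) (\<lambda>_. count_space UNIV)) (count_space UNIV)"
      by (intro measurable_add_nat measurable_sum_nat comp) auto
  qed
  also have "(\<lambda>t \<omega>. ?Y t (restrict (\<lambda>k. noise As Bs k \<omega>) (?K t))) = (\<lambda>t. transition t (m t))"
    by (auto simp: fun_eq_iff transition_def intro!: sum.cong)
  finally show ?thesis .
qed

lemma transition_measurable [measurable]: "transition t m \<in> measurable M (count_space UNIV)"
  using indep_transition[of "\<lambda>_. m"] by (auto simp: indep_vars_def)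

lemma transition_law: "prob {\<omega> \<in> space M. transition t m \<omega> = y} = pmf (step m) y"
proof -
  let ?I = "(UNIV \<times> {1..}) <+> UNIV :: ((int \<times> nat) + int) set"
  have "indep_vars (\<lambda>i. PiM {Inl (t, i)} (\<lambda>_. count_space UNIV)) (\<lambda>i \<omega>. restrict (\<lambda>k. noise As Bs k \<omega>) {Inl (t, i)}) {1..}"
    by (rule indep_vars_restrict[OF indep_noise]) (auto simp: disjoint_family_on_def)
  then have "indep_vars (\<lambda>_. count_space UNIV) (\<lambda>i \<omega>. restrict (\<lambda>k. noise As Bs k \<omega>) {Inl (t, i)} (Inl (t, i))) {1..}"
    by (rule indep_vars_compose2) (auto intro!: measurable_component_singleton)
  then have "indep_vars (\<lambda>_. count_space UNIV) (As t) {1..}"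
    by simp
  from prob_indep_sum_iid[OF this offspring_law]
  have sum_law: "prob {\<omega> \<in> space M. (\<Sum>i=1..m. As t i \<omega>) = y} = pmf (gw m) y" for y
    by (simp add: gw_def)
  have "indep_var (PiM (Inl ` ({t} \<times> {1..m})) (\<lambda>_. count_space UNIV)) (\<lambda>\<omega>. restrict (\<lambda>k. noise As Bs k \<omega>) (Inl ` ({t} \<times> {1..m})))
      (PiM {Inr t} (\<lambda>_. count_space UNIV)) (\<lambda>\<omega>. restrict (\<lambda>k. noise As Bs k \<omega>) {Inr t})"
    by (rule indep_var_restrict[OF indep_noise]) auto
  then have "indep_var (count_space UNIV) ((\<lambda>f. \<Sum>i=1..m. f (Inl (t, i))) \<circ> (\<lambda>\<omega>. restrict (\<lambda>k. noise As Bs k \<omega>) (Inl ` ({t} \<times> {1..m}))))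
      (count_space UNIV) ((\<lambda>f. f (Inr t)) \<circ> (\<lambda>\<omega>. restrict (\<lambda>k. noise As Bs k \<omega>) {Inr t}))"
  proof (rule indep_var_compose)
    have "(\<lambda>f. f (Inl (t, i))) \<in> measurable (PiM (Inl ` ({t} \<times> {1..m})) (\<lambda>_. count_space UNIV)) (count_space (UNIV :: nat set))" if "i \<in> {1..m}" for i
      using that by (intro measurable_component_singleton) auto
    then show "(\<lambda>f. \<Sum>i=1..m. f (Inl (t, i))) \<in> measurable (PiM (Inl ` ({t} \<times> {1..m})) (\<lambda>_. count_space UNIV)) (count_space (UNIV :: nat set))"
      by (intro measurable_sum_nat) auto
  qed (auto intro!: measurable_component_singleton)
  also have "(\<lambda>f. \<Sum>i=1..m. f (Inl (t, i))) \<circ> (\<lambda>\<omega>. restrict (\<lambda>k. noise As Bs k \<omega>) (Inl ` ({t} \<times> {1..m}))) = (\<lambda>\<omega>. \<Sum>i=1..m. As t i \<omega>)"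
    by (auto simp: fun_eq_iff intro!: sum.cong)
  also have "(\<lambda>f. f (Inr t)) \<circ> (\<lambda>\<omega>. restrict (\<lambda>k. noise As Bs k \<omega>) {Inr t}) = Bs t"
    by (auto simp: fun_eq_iff)
  finally have "indep_var (count_space UNIV) (\<lambda>\<omega>. \<Sum>i=1..m. As t i \<omega>) (count_space UNIV) (Bs t)" .
  from prob_indep_sum[OF this sum_law immigration_law] show ?thesis
    by (simp add: transition_def step_def)
qed

text \<open>A path is prescribed through the noise: as all population sizes are constants,
  the event splits into one about \<open>X t\<close> and one about the later noise only.\<close>

lemma prob_path_transitions:
  "prob {\<omega> \<in> space M. X t \<omega> = x 0 \<and> (\<forall>j\<in>{1..n}. transition (t + int j) (x (j - 1)) \<omega> = x j)} =
    prob {\<omega> \<in> space M. X t \<omega> = x 0} * (\<Prod>j=1..n. pmf (step (x (j - 1))) (x j))"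
proof -
  let ?a = "{\<omega> \<in> space M. X t \<omega> = x 0}"
  let ?b = "{\<omega> \<in> space M. \<forall>j\<in>{1..n}. transition (t + int j) (x (j - 1)) \<omega> = x j}"
  let ?K = "noise_from (t + 1)"
  let ?F = "\<lambda>\<omega>. \<lambda>k\<in>?K. noise As Bs k \<omega>"
  let ?P = "\<Pi>\<^sub>M k\<in>?K. count_space UNIV :: nat measure"
  have "X t -` {x 0} \<inter> space M \<in> sets (vimage_algebra (space M) (X (t + 1 - 1)) (count_space UNIV))"
    using in_vimage_algebra[of "{x 0}" "count_space UNIV" "X t" "space M"] by simp
  then have a: "?a \<in> sets (vimage_algebra (space M) (X (t + 1 - 1)) (count_space UNIV))"
    by (simp add: vimage_def Int_def conj_commute)
  have b: "?b \<in> sets (vimage_algebra (space M) ?F ?P)"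
  proof -
    let ?S = "{f \<in> space ?P. \<forall>j\<in>{1..n}. (\<Sum>i=1..x (j - 1). f (Inl (t + int j, i))) + f (Inr (t + int j)) = x j}"
    have comp: "(\<lambda>f. f k) \<in> measurable ?P (count_space UNIV)" if "k \<in> ?K" for k
      using that by (rule measurable_component_singleton)
    have meas: "(\<lambda>f. (\<Sum>i=1..x (j - 1). f (Inl (t + int j, i))) + f (Inr (t + int j))) \<in> measurable ?P (count_space UNIV)"
      if "j \<in> {1..n}" for j
      using that by (intro measurable_add_nat measurable_sum_nat comp) (auto simp: noise_from_def)
    have "{f \<in> space ?P. (\<Sum>i=1..x (j - 1). f (Inl (t + int j, i))) + f (Inr (t + int j)) = x j} \<in> sets ?P"
      if "j \<in> {1..n}" for j
      using measurable_sets[OF meas[OF that], of "{x j}"] by (simp add: vimage_def Int_def conj_commute)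
    then have "?S \<in> sets ?P"
      by (intro sets.sets_Collect_finite_All) auto
    then have "?F -` ?S \<inter> space M \<in> sets (vimage_algebra (space M) ?F ?P)"
      by (rule in_vimage_algebra)
    also have "?F -` ?S \<inter> space M = ?b"
    proof -
      have "(\<Sum>i=1..m. ?F \<omega> (Inl (t + int j, i))) + ?F \<omega> (Inr (t + int j)) = transition (t + int j) m \<omega>"
        if "j \<in> {1..n}" for j m \<omega>
      proof -
        have "Inr (t + int j) \<in> ?K" and "\<And>i. i \<in> {1..m} \<Longrightarrow> Inl (t + int j, i) \<in> ?K"
          using that by (auto simp: noise_from_def)
        then show ?thesis by (simp add: transition_def)
      qed
      moreover have "?F \<omega> \<in> space ?P" for \<omega>
        by (simp add: space_PiM)
      ultimately show ?thesis
        by (intro set_eqI) (simp only: vimage_eq Int_iff mem_Collect_eq cong: ball_cong, blast)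
    qed
    finally show ?thesis .
  qed
  have "prob ?b = (\<Prod>j=1..n. pmf (step (x (j - 1))) (x j))"
  proof (cases "n = 0")
    case True
    then show ?thesis by (simp add: prob_space)
  next
    case False
    let ?m = "\<lambda>s. x (nat (s - t) - 1)"
    have inj: "inj_on (\<lambda>j. t + int j) {1..n}" by (auto intro: inj_onI)
    have b_eq: "?b = (\<Inter>s\<in>(\<lambda>j. t + int j) ` {1..n}. transition s (?m s) -` {x (nat (s - t))} \<inter> space M)"
      using False by auto
    have "prob ?b = (\<Prod>s\<in>(\<lambda>j. t + int j) ` {1..n}. prob (transition s (?m s) -` {x (nat (s - t))} \<inter> space M))"
      unfolding b_eq
      using False by (intro indep_varsD_finite[OF indep_vars_subset[OF indep_transition[of ?m]]]) auto
    also have "\<dots> = (\<Prod>j=1..n. prob {\<omega> \<in> space M. transition (t + int j) (x (j - 1)) \<omega> = x j})"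
      by (subst prod.reindex[OF inj]) (auto intro!: prod.cong arg_cong[where f = prob])
    finally show ?thesis by (simp add: transition_law)
  qed
  moreover have "prob (?a \<inter> ?b) = prob ?a * prob ?b"
    by (rule indep_setD[OF indep_past a b])
  moreover have "?a \<inter> ?b = {\<omega> \<in> space M. X t \<omega> = x 0 \<and> (\<forall>j\<in>{1..n}. transition (t + int j) (x (j - 1)) \<omega> = x j)}"
    by auto
  ultimately show ?thesis by simp
qed

text \<open>Almost surely the recursion turns the prescribed path of \<open>X\<close> into the event of
  \<open>prob_path_transitions\<close>.\<close>

lemma prob_path:
  "prob {\<omega> \<in> space M. X t \<omega> = x 0 \<and> (\<forall>j\<in>{1..n}. X (t + int j) \<omega> = x j)} =
    prob {\<omega> \<in> space M. X t \<omega> = x 0} * (\<Prod>j=1..n. pmf (step (x (j - 1))) (x j))"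
proof -
  have "AE \<omega> in M. \<forall>j\<in>{1..n}. X (t + int j) \<omega> = transition (t + int j) (X (t + int j - 1) \<omega>) \<omega>"
    unfolding transition_def by (intro AE_finite_allI recursion) auto
  then have "AE \<omega> in M. (X t \<omega> = x 0 \<and> (\<forall>j\<in>{1..n}. X (t + int j) \<omega> = x j)) \<longleftrightarrow>
      (X t \<omega> = x 0 \<and> (\<forall>j\<in>{1..n}. transition (t + int j) (x (j - 1)) \<omega> = x j))"
  proof eventually_elim
    case (elim \<omega>)
    have rec: "X (t + int (Suc j)) \<omega> = transition (t + int (Suc j)) (X (t + int j) \<omega>) \<omega>" if "j < n" for j
      using bspec[OF elim, of "Suc j"] that by (simp add: add.assoc[symmetric])
    have "X (t + int j) \<omega> = x j"
      if that: "X t \<omega> = x 0" "\<forall>j\<in>{1..n}. transition (t + int j) (x (j - 1)) \<omega> = x j" "j \<le> n" for j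
      using that(3)
    proof (induction j)
      case (Suc j)
      then show ?case using rec[of j] bspec[OF that(2), of "Suc j"] by simp
    qed (simp add: that)
    moreover have "transition (t + int j) (x (j - 1)) \<omega> = x j"
      if prem: "X t \<omega> = x 0" "\<forall>j\<in>{1..n}. X (t + int j) \<omega> = x j" "j \<in> {1..n}" for j
    proof -
      obtain i where i: "j = Suc i" using prem(3) by (cases j) auto
      have "X (t + int i) \<omega> = x i"
        using prem(1) bspec[OF prem(2), of i] prem(3) i by (cases "i = 0") auto
      moreover have "X (t + int j) \<omega> = x j" by (rule bspec[OF prem(2,3)])
      moreover have "i < n" using prem(3) i by auto
      ultimately show ?thesis using rec[of i] i by simp
    qed
    ultimately show ?case by auto
  qed
  then show ?thesis
    unfolding prob_path_transitions[symmetric]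
    by (intro finite_measure_eq_AE) auto
qed

text \<open>The Markov property for staying below \<open>u\<close>: by induction on \<open>k\<close>, splitting according to the next state,
  for which only finitely many values are admissible.\<close>

lemma prob_path_stay:
  "ennreal (prob {\<omega> \<in> space M. X t \<omega> = x 0 \<and> (\<forall>j\<in>{1..n}. X (t + int j) \<omega> = x j) \<and>
      (\<forall>j\<in>{n+1..n+k}. real (X (t + int j) \<omega>) \<le> u)}) =
    ennreal (prob {\<omega> \<in> space M. X t \<omega> = x 0} * (\<Prod>j=1..n. pmf (step (x (j - 1))) (x j))) * stay u k (x n)"
proof (induction k arbitrary: n x)
  case 0
  show ?case by (simp add: prob_path[of t x n, simplified])
next
  case (Suc k)
  \<comment> \<open>The admissible values of the next state and, for each of them, the path prolonged by that value.\<close>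
  define Y where "Y = {y::nat. real y \<le> u}"
  have Y: "finite Y"
    by (rule finite_subset[of _ "{..nat \<lfloor>u\<rfloor>}"]) (auto simp: Y_def le_nat_floor)
  define E where "E y = {\<omega> \<in> space M. X t \<omega> = (x(Suc n := y)) 0 \<and> (\<forall>j\<in>{1..Suc n}. X (t + int j) \<omega> = (x(Suc n := y)) j) \<and>
      (\<forall>j\<in>{Suc n+1..Suc n+k}. real (X (t + int j) \<omega>) \<le> u)}" for y
  define c where "c = prob {\<omega> \<in> space M. X t \<omega> = x 0} * (\<Prod>j=1..n. pmf (step (x (j - 1))) (x j))"
  have c: "c \<ge> 0" by (simp add: c_def prod_nonneg)
  have E: "ennreal (prob (E y)) = ennreal c * (ennreal (pmf (step (x n)) y) * stay u k y)" for y
  proof -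
    have "(\<Prod>j=1..n. pmf (step ((x(Suc n := y)) (j - 1))) ((x(Suc n := y)) j)) = (\<Prod>j=1..n. pmf (step (x (j - 1))) (x j))"
      by (intro prod.cong) auto
    moreover have "(\<Prod>j=1..Suc n. pmf (step ((x(Suc n := y)) (j - 1))) ((x(Suc n := y)) j)) =
        (\<Prod>j=1..n. pmf (step ((x(Suc n := y)) (j - 1))) ((x(Suc n := y)) j)) * pmf (step (x n)) y"
      by (subst prod.nat_ivl_Suc') (auto simp: mult.commute)
    ultimately have "prob {\<omega> \<in> space M. X t \<omega> = (x(Suc n := y)) 0} * (\<Prod>j=1..Suc n. pmf (step ((x(Suc n := y)) (j - 1))) ((x(Suc n := y)) j))
        = c * pmf (step (x n)) y"
      by (simp only: c_def mult.assoc) simp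
    then have "ennreal (prob (E y)) = ennreal (c * pmf (step (x n)) y) * stay u k ((x(Suc n := y)) (Suc n))"
      unfolding E_def Suc.IH[of "x(Suc n := y)" "Suc n"] by (simp only:)
    then show ?thesis using c by (simp add: ennreal_mult mult.assoc)
  qed
  have E_last: "X (t + int (Suc n)) \<omega> = y" if "\<omega> \<in> E y" for \<omega> y
  proof -
    have "\<forall>j\<in>{1..Suc n}. X (t + int j) \<omega> = (x(Suc n := y)) j" using that unfolding E_def by blast
    from bspec[OF this, of "Suc n"] show ?thesis by simp
  qed
  have "{\<omega> \<in> space M. X t \<omega> = x 0 \<and> (\<forall>j\<in>{1..n}. X (t + int j) \<omega> = x j) \<and>
      (\<forall>j\<in>{n+1..n+Suc k}. real (X (t + int j) \<omega>) \<le> u)} = (\<Union>y\<in>Y. E y)"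
  proof (intro set_eqI iffI)
    fix \<omega> assume *: "\<omega> \<in> {\<omega> \<in> space M. X t \<omega> = x 0 \<and> (\<forall>j\<in>{1..n}. X (t + int j) \<omega> = x j) \<and>
      (\<forall>j\<in>{n+1..n+Suc k}. real (X (t + int j) \<omega>) \<le> u)}"
    then have "\<forall>j\<in>{n+1..n+Suc k}. real (X (t + int j) \<omega>) \<le> u" by blast
    from bspec[OF this, of "Suc n"] have "real (X (t + int (Suc n)) \<omega>) \<le> u" by simp
    moreover have "\<omega> \<in> E (X (t + int (Suc n)) \<omega>)"
      using * by (auto simp: E_def le_Suc_eq)
    ultimately show "\<omega> \<in> (\<Union>y\<in>Y. E y)" unfolding Y_def by blast
  next
    fix \<omega> assume "\<omega> \<in> (\<Union>y\<in>Y. E y)"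
    then obtain y where y: "real y \<le> u" "\<omega> \<in> E y" by (auto simp: Y_def)
    have "X (t + int j) \<omega> = x j" if "j \<in> {1..n}" for j
      using y(2) that by (auto simp: E_def dest!: bspec[of _ _ j])
    moreover have "real (X (t + int j) \<omega>) \<le> u" if "j \<in> {n+1..n+Suc k}" for j
    proof (cases "j = Suc n")
      case True
      have "X (t + int (Suc n)) \<omega> = y" using y(2) by (rule E_last)
      then show ?thesis using y True by simp
    next
      case False
      then show ?thesis using y(2) that unfolding E_def by auto
    qed
    ultimately show "\<omega> \<in> {\<omega> \<in> space M. X t \<omega> = x 0 \<and> (\<forall>j\<in>{1..n}. X (t + int j) \<omega> = x j) \<and>
      (\<forall>j\<in>{n+1..n+Suc k}. real (X (t + int j) \<omega>) \<le> u)}"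
      using y(2) by (auto simp: E_def)
  qed
  moreover have "prob (\<Union>y\<in>Y. E y) = (\<Sum>y\<in>Y. prob (E y))"
  proof (rule finite_measure_finite_Union[OF Y])
    show "E ` Y \<subseteq> events" unfolding E_def by auto
    show "disjoint_family_on E Y" unfolding disjoint_family_on_def using E_last by blast
  qed
  moreover have "ennreal (\<Sum>y\<in>Y. prob (E y)) = ennreal c * stay u (Suc k) (x n)"
  proof -
    have "ennreal (\<Sum>y\<in>Y. prob (E y)) = (\<Sum>y\<in>Y. ennreal (prob (E y)))" by simp
    also have "\<dots> = ennreal c * (\<Sum>y\<in>Y. ennreal (pmf (step (x n)) y) * stay u k y)"
      by (simp add: E sum_distrib_left)
    also have "(\<Sum>y\<in>Y. ennreal (pmf (step (x n)) y) * stay u k y) = stay u (Suc k) (x n)"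
    proof -
      have "stay u (Suc k) (x n) = (\<Sum>y\<in>Y. (if real y \<le> u then stay u k y else 0) * pmf (step (x n)) y)"
        unfolding stay_below.simps by (rule nn_integral_measure_pmf_support[OF Y]) (auto simp: Y_def)
      also have "\<dots> = (\<Sum>y\<in>Y. ennreal (pmf (step (x n)) y) * stay u k y)"
        by (intro sum.cong) (auto simp: Y_def mult.commute)
      finally show ?thesis by simp
    qed
    finally show ?thesis .
  qed
  ultimately show ?case by (simp add: c_def)
qed

lemma emeasure_decompose:
  assumes [measurable]: "Measurable.pred M P"
  shows "emeasure M {\<omega> \<in> space M. P \<omega>} = (\<integral>\<^sup>+x. ennreal (prob {\<omega> \<in> space M. X t \<omega> = x \<and> P \<omega>}) \<partial>count_space UNIV)"
proof -
  have "{\<omega> \<in> space M. P \<omega>} = (\<Union>x\<in>UNIV. {\<omega> \<in> space M. X t \<omega> = x \<and> P \<omega>})" by auto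
  then have "emeasure M {\<omega> \<in> space M. P \<omega>} = (\<integral>\<^sup>+x. emeasure M {\<omega> \<in> space M. X t \<omega> = x \<and> P \<omega>} \<partial>count_space UNIV)"
    by (simp only:) (intro emeasure_UN_countable, auto simp: disjoint_family_on_def)
  then show ?thesis by (simp add: emeasure_eq_measure)
qed

lemma prob_stay:
  assumes "\<And>x. prob {\<omega> \<in> space M. X t \<omega> = x} = pmf \<pi> x"
  shows "ennreal (prob {\<omega> \<in> space M. \<forall>j\<in>{1..k}. real (X (t + int j) \<omega>) \<le> u}) = (\<integral>\<^sup>+x. stay u k x \<partial>\<pi>)"
proof -
  have "emeasure M {\<omega> \<in> space M. \<forall>j\<in>{1..k}. real (X (t + int j) \<omega>) \<le> u} =
      (\<integral>\<^sup>+x. ennreal (prob {\<omega> \<in> space M. X t \<omega> = x \<and> (\<forall>j\<in>{1..k}. real (X (t + int j) \<omega>) \<le> u)}) \<partial>count_space UNIV)"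
    by (rule emeasure_decompose) measurable
  also have "\<dots> = (\<integral>\<^sup>+x. ennreal (pmf \<pi> x) * stay u k x \<partial>count_space UNIV)"
    using prob_path_stay[of t "\<lambda>_. x" 0 k u for x] by (simp add: assms)
  finally show ?thesis by (simp add: nn_integral_measure_pmf emeasure_eq_measure)
qed

lemma law_invariant:
  assumes "\<And>x. prob {\<omega> \<in> space M. X t \<omega> = x} = pmf \<pi> x"
    and "\<And>x. prob {\<omega> \<in> space M. X (t + 1) \<omega> = x} = pmf \<pi> x"
  shows "bind_pmf \<pi> step = \<pi>"
proof (rule pmf_eqI)
  fix y
  have "ennreal (pmf \<pi> y) = emeasure M {\<omega> \<in> space M. X (t + 1) \<omega> = y}"
    by (simp add: emeasure_eq_measure assms)
  also have "\<dots> = (\<integral>\<^sup>+x. ennreal (prob {\<omega> \<in> space M. X t \<omega> = x \<and> X (t + 1) \<omega> = y}) \<partial>count_space UNIV)"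
    by (rule emeasure_decompose) measurable
  also have "\<dots> = (\<integral>\<^sup>+x. ennreal (pmf \<pi> x) * ennreal (pmf (step x) y) \<partial>count_space UNIV)"
  proof (rule nn_integral_cong)
    fix x
    have "prob {\<omega> \<in> space M. X t \<omega> = x \<and> X (t + 1) \<omega> = y} = pmf \<pi> x * pmf (step x) y"
      using prob_path[of t "\<lambda>j. if j = 0 then x else y" 1] by (simp add: assms)
    then show "ennreal (prob {\<omega> \<in> space M. X t \<omega> = x \<and> X (t + 1) \<omega> = y}) = ennreal (pmf \<pi> x) * ennreal (pmf (step x) y)"
      by (simp add: ennreal_mult)
  qed
  also have "\<dots> = ennreal (pmf (bind_pmf \<pi> step) y)"
    by (simp add: ennreal_pmf_bind nn_integral_measure_pmf)
  finally show "pmf (bind_pmf \<pi> step) y = pmf \<pi> y" by simp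
qed

end

section \<open>The limit law of the maximum\<close>

lemma prob_pmf_of_distr:
  fixes Y :: "'a \<Rightarrow> nat"
  assumes "measure_pmf p = distr M (count_space UNIV) Y" "Y \<in> measurable M (count_space UNIV)"
  shows "measure M {\<omega> \<in> space M. Y \<omega> = y} = pmf p y"
proof -
  have "pmf p y = measure (measure_pmf p) {y}" by (simp add: pmf.rep_eq)
  also have "\<dots> = measure M (Y -` {y} \<inter> space M)"
    unfolding assms(1) by (rule measure_distr[OF assms(2)]) simp
  also have "Y -` {y} \<inter> space M = {\<omega> \<in> space M. Y \<omega> = y}" by auto
  finally show ?thesis by simp
qed

text \<open>Stationarity of the whole path, projected to the coordinate at time \<open>0\<close>.\<close>

lemma strictly_stationary_distr:
  assumes "strictly_stationary M X"
  shows "distr M (count_space UNIV) (X t) = distr M (count_space UNIV) (X 0)"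
proof -
  have X: "X s \<in> measurable M (count_space UNIV)" for s
    using assms by (simp add: strictly_stationary_def)
  let ?P = "\<Pi>\<^sub>M t\<in>(UNIV :: int set). count_space (UNIV :: nat set)"
  have path: "(\<lambda>\<omega> s. X (s + h) \<omega>) \<in> measurable M ?P" for h
    by (rule measurable_PiM_single') (use X in \<open>auto simp: space_PiM\<close>)
  have component: "(\<lambda>f. f 0) \<in> measurable ?P (count_space UNIV)"
    by (rule measurable_component_singleton) simp
  have "distr (distr M ?P (\<lambda>\<omega> s. X (s + t) \<omega>)) (count_space UNIV) (\<lambda>f. f 0) =
      distr (distr M ?P (\<lambda>\<omega> s. X s \<omega>)) (count_space UNIV) (\<lambda>f. f 0)"
    using assms by (simp add: strictly_stationary_def)
  then show ?thesis
    using path[of 0] by (simp add: distr_distr[OF component path] distr_distr[OF component] comp_def)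
qed

theorem corollary3p3:
  fixes N :: "'b measure" and A B :: "'b \<Rightarrow> nat"
    and M :: "'a measure" and As :: "int \<Rightarrow> nat \<Rightarrow> 'a \<Rightarrow> nat"
    and Bs X :: "int \<Rightarrow> 'a \<Rightarrow> nat"
    and \<alpha> \<mu> :: real and a :: "nat \<Rightarrow> real"
  assumes "prob_space N"
    and "A \<in> measurable N (count_space UNIV)"
    and "B \<in> measurable N (count_space UNIV)"
    and "integrable N (\<lambda>\<omega>. real (A \<omega>))"
    and "\<mu> = (\<integral>\<omega>. real (A \<omega>) \<partial>N)"
    and "0 < \<mu>" and "\<mu> < 1"
    and "model_I N A B \<alpha> \<or> model_II N A B \<alpha>"
    and "stationary_branching_process N A B M As Bs X"
    and "\<forall>u>0. (\<lambda>n. real n * \<P>(\<omega> in M. real (X 0 \<omega>) > a n * u)) \<longlonglongrightarrow> u powr (-\<alpha>)"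
  shows "\<forall>x\<ge>0. (\<lambda>n. \<P>(\<omega> in M. real (Max ((\<lambda>t. X (int t) \<omega>) ` {1..n})) / a n \<le> x))
           \<longlonglongrightarrow> (if x = 0 then 0 else exp (- (1 - \<mu> powr \<alpha>) * x powr (-\<alpha>)))"
proof -
  have alpha: "\<alpha> > 0"
    using assms(8) by (auto simp: model_I_def model_II_def)
  note sbp = assms(9)[unfolded stationary_branching_process_def]
  interpret N: prob_space N by fact
  interpret M: prob_space M using sbp by simp
  obtain pA where pA: "measure_pmf pA = distr N (count_space UNIV) A"
    using N.obtain_law_pmf[OF assms(2)] by blast
  obtain pB where pB: "measure_pmf pB = distr N (count_space UNIV) B"
    using N.obtain_law_pmf[OF assms(3)] by blast
  have stat: "strictly_stationary M X" using sbp by simp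
  then have X [measurable]: "X t \<in> measurable M (count_space UNIV)" for t
    by (simp add: strictly_stationary_def)
  obtain \<pi> where \<pi>: "measure_pmf \<pi> = distr M (count_space UNIV) (X 0)"
    using M.obtain_law_pmf[OF X] by blast
  have X_law: "M.prob {\<omega> \<in> space M. X t \<omega> = x} = pmf \<pi> x" for t x
    using \<pi> strictly_stationary_distr[OF stat, of t] by (intro prob_pmf_of_distr X) simp
  have indep: "M.indep_vars (\<lambda>_. count_space UNIV) (noise As Bs) ((UNIV \<times> {1..}) <+> UNIV)"
    using sbp by simp
  have noise_measurable: "noise As Bs k \<in> measurable M (count_space UNIV)" if "k \<in> (UNIV \<times> {1..}) <+> UNIV" for k
    using indep that unfolding M.indep_vars_def by blast
  have As_measurable: "As t i \<in> measurable M (count_space UNIV)" if "i \<ge> 1" for t i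
    using noise_measurable[of "Inl (t, i)"] that by auto
  have Bs_measurable: "Bs t \<in> measurable M (count_space UNIV)" for t
    using noise_measurable[of "Inr t"] by auto
  interpret branching_process M pA pB As Bs X
  proof unfold_locales
    show "M.prob {\<omega> \<in> space M. As t i \<omega> = y} = pmf pA y" if "i \<ge> 1" for t i y
      using sbp that pA As_measurable by (intro prob_pmf_of_distr) auto
    show "M.prob {\<omega> \<in> space M. Bs t \<omega> = y} = pmf pB y" for t y
      using sbp pB Bs_measurable by (intro prob_pmf_of_distr) auto
  qed (use sbp X in auto)
  interpret stationary_branching_kernel pA pB \<pi> \<mu>
  proof unfold_locales
    have "(\<integral>\<^sup>+x. ennreal (real x) \<partial>pA) = (\<integral>\<^sup>+\<omega>. ennreal (real (A \<omega>)) \<partial>N)"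
      unfolding pA using assms(2) by (subst nn_integral_distr) auto
    also have "\<dots> = ennreal \<mu>"
      unfolding assms(5) using assms(4) by (intro nn_integral_eq_integral) auto
    finally show "(\<integral>\<^sup>+x. ennreal (real x) \<partial>pA) = ennreal \<mu>" .
    show "bind_pmf \<pi> step = \<pi>"
      using X_law by (intro law_invariant[of 0]) auto
  qed (use assms in auto)
  have tail_eq: "tail v = \<P>(\<omega> in M. real (X 0 \<omega>) > v)" for v
  proof -
    have "tail v = measure M (X 0 -` {x. v < real x} \<inter> space M)"
      unfolding tail_def \<pi> by (rule measure_distr[OF X]) simp
    also have "X 0 -` {x. v < real x} \<inter> space M = {\<omega> \<in> space M. v < real (X 0 \<omega>)}" by auto
    finally show ?thesis .
  qed
  have lim: "(\<lambda>n. real n * tail (a n * u)) \<longlonglongrightarrow> u powr (- \<alpha>)" if "u > 0" for u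
    using assms(10) that by (simp add: tail_eq)
  have a_lim: "\<forall>\<^sub>F n in sequentially. 0 < a n"
    using norming_sequence_at_top[OF lim] by (auto simp: filterlim_at_top_dense)
  have max_eq: "\<P>(\<omega> in M. real (Max ((\<lambda>t. X (int t) \<omega>) ` {1..n})) / a n \<le> x) = no_exceedance (a n * x) n"
    if "0 < a n" "0 < n" for n x
  proof -
    have "real (Max ((\<lambda>t. X (int t) \<omega>) ` {1..n})) / a n \<le> x \<longleftrightarrow> (\<forall>j\<in>{1..n}. real (X (0 + int j) \<omega>) \<le> a n * x)" for \<omega>
    proof -
      let ?S = "(\<lambda>t. X (int t) \<omega>) ` {1..n}"
      have "real (Max ?S) = Max (real ` ?S)"
        using that by (intro mono_Max_commute) (auto simp: mono_def)
      then have "real (Max ?S) \<le> a n * x \<longleftrightarrow> (\<forall>j\<in>{1..n}. real (X (int j) \<omega>) \<le> a n * x)"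
        using that by simp
      then show ?thesis using that by (simp add: divide_le_eq mult.commute)
    qed
    moreover have "ennreal (M.prob {\<omega> \<in> space M. \<forall>j\<in>{1..n}. real (X (0 + int j) \<omega>) \<le> a n * x}) = ennreal (no_exceedance (a n * x) n)"
      unfolding ennreal_no_exceedance using X_law by (rule prob_stay)
    ultimately show ?thesis
      using no_exceedance_nonneg by simp
  qed
  have pos_lim: "(\<lambda>n. \<P>(\<omega> in M. real (Max ((\<lambda>t. X (int t) \<omega>) ` {1..n})) / a n \<le> x))
      \<longlonglongrightarrow> exp (- (1 - \<mu> powr \<alpha>) * x powr (-\<alpha>))" if "x > 0" for x
  proof (rule Lim_transform_eventually[OF no_exceedance_tendsto[OF lim that]])
    show "\<forall>\<^sub>F n in sequentially. no_exceedance (a n * x) n = \<P>(\<omega> in M. real (Max ((\<lambda>t. X (int t) \<omega>) ` {1..n})) / a n \<le> x)"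
      using a_lim eventually_gt_at_top[of 0] by eventually_elim (simp only: max_eq)
  qed
  \<comment> \<open>For \<open>x = 0\<close> the probability is at most that for any \<open>x > 0\<close>, whose limit is small for small \<open>x\<close>.\<close>
  have zero_lim: "(\<lambda>n. \<P>(\<omega> in M. real (Max ((\<lambda>t. X (int t) \<omega>) ` {1..n})) / a n \<le> 0)) \<longlonglongrightarrow> 0"
  proof (rule decreasing_tendsto)
    fix e :: real assume "0 < e"
    define \<theta> where "\<theta> = 1 - \<mu> powr \<alpha>"
    have "\<theta> > 0" using alpha assms(6,7) powr_less_mono2[of \<alpha> \<mu> 1] by (simp add: \<theta>_def)
    then have "((\<lambda>x. exp (- \<theta> * x powr (-\<alpha>))) \<longlongrightarrow> 0) (at_right 0)"
      using alpha by real_asymp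
    then have "\<forall>\<^sub>F x in at_right 0. exp (- \<theta> * x powr (-\<alpha>)) < e \<and> 0 < x"
      using \<open>0 < e\<close> by (intro eventually_conj order_tendstoD(2) eventually_at_right_less) auto
    then obtain x where x: "exp (- \<theta> * x powr (-\<alpha>)) < e" "0 < x"
      using eventually_happens'[OF trivial_limit_at_right_real] by blast
    have "\<forall>\<^sub>F n in sequentially. \<P>(\<omega> in M. real (Max ((\<lambda>t. X (int t) \<omega>) ` {1..n})) / a n \<le> x) < e"
      using order_tendstoD(2)[OF pos_lim[OF x(2)]] x(1) by (simp add: \<theta>_def)
    then show "\<forall>\<^sub>F n in sequentially. \<P>(\<omega> in M. real (Max ((\<lambda>t. X (int t) \<omega>) ` {1..n})) / a n \<le> 0) < e"
      using a_lim eventually_gt_at_top[of 0]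
    proof eventually_elim
      case (elim n)
      have "ennreal (no_exceedance (a n * 0) n) \<le> ennreal (no_exceedance (a n * x) n)"
      proof -
        have "M.prob {\<omega> \<in> space M. \<forall>j\<in>{1..n}. real (X (0 + int j) \<omega>) \<le> a n * 0} \<le>
            M.prob {\<omega> \<in> space M. \<forall>j\<in>{1..n}. real (X (0 + int j) \<omega>) \<le> a n * x}"
          using x(2) elim(2) by (intro M.finite_measure_mono) (auto intro: order_trans[OF eq_refl])
        from ennreal_leI[OF this] show ?thesis
          by (simp only: ennreal_no_exceedance prob_stay[OF X_law])
      qed
      then have "no_exceedance (a n * 0) n \<le> no_exceedance (a n * x) n"
        using no_exceedance_nonneg by simp
      then show ?case using elim by (simp only: max_eq)
    qed
  qed simp
  show ?thesis
    using pos_lim zero_lim by auto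
qed

end
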